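(* Let $d\ge1$. There exists a score estimator $\hat s_t(x)$ (constructed from $n$ i.i.d. samples $x_1,\dots,x_n\sim p_0$) such that, whenever the probability density $p_0$ on $\mathbb{R}^d$ is $\sigma_0$-sub-Gaussian, the following hold with $s_t:=\nabla\log p_t$ and arbitrary constants $T_1,T_2>0$. 1. For $t_0=n^{-T_1}$ and $T=n^{T_2}$, $$\int_{t_0}^T\mathbb{E}\left[\int_{\mathbb{R}^d}\|\hat s_t(x)-s_t(x)\|^2p_t(x)\,dx\right]dt\ \lesssim\ \mathrm{polylog}(n)\,n^{-1}\,t_0^{-d/2}.$$ 2. In particular, for any $\beta>0$, with $t_0=n^{-\frac{2}{2\beta+d}}$ and $T=n^{T_2}$, $$\int_{t_0}^T\mathbb{E}\left[\int_{\mathbb{R}^d}\|\hat s_t(x)-s_t(x)\|^2p_t(x)\,dx\right]dt\ \lesssim\ \mathrm{polylog}(n)\,n^{-\frac{2\beta}{2\beta+d}}.$$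
   Context: Sub-Gaussian: for a real random variable $Y$, $\|Y\|_{\psi_2}=\inf\{C>0:\mathbb{E}[e^{Y^2/C^2}-1]\le 1\}$; for a random vector $X\in\mathbb{R}^d$, $\|X\|_{\psi_2}=\sup_{v\in S^{d-1}}\|\langle X,v\rangle\|_{\psi_2}$. $X$ (or its law/density) is $\sigma$-sub-Gaussian if $\sigma=\|X\|_{\psi_2}<\infty$. $p_0$ is a probability density on $\mathbb{R}^d$; $p_t:=p_0*\phi_t$, where $\phi_t$ is the density of $\mathcal{N}(0,tI_d)$. A score estimator is a rule which, for each sample size $n\ge 2$ and time $t>0$, produces a function $\hat s_t:\mathbb{R}^d\to\mathbb{R}^d$ from the samples $x_1,\dots,x_n$ (i.i.d. from $p_0$), possibly using auxiliary randomness independent of the samples; the rule itself does not depend on the unknown $p_0$. The expectation $\mathbb{E}$ is over the samples and any auxiliary randomness. $\mathrm{polylog}(n):=(\log n)^C$ for some constant $C$. The symbol $\lesssim$ hides constants; these (and the exponent $C$) may depend on $p_0$, $d$, $T_1,T_2,\beta$, but not on $n$ (nor on $t$). *)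

theory Defs
  imports "HOL-Probability.Probability"
begin

definition prob_density :: "(real ^ 'd \<Rightarrow> real) \<Rightarrow> bool" where
  "prob_density p \<longleftrightarrow>
     p \<in> borel_measurable borel \<and> (\<forall>x. 0 \<le> p x) \<and> (\<integral>\<^sup>+x. ennreal (p x) \<partial>lborel) = 1"

definition law :: "(real ^ 'd \<Rightarrow> real) \<Rightarrow> (real ^ 'd) measure" where
  "law p = density lborel (\<lambda>x. ennreal (p x))"

text \<open>The Orlicz norm takes the value \<open>\<infinity>\<close> (the infimum of the empty set in
  \<^typ>\<open>ennreal\<close>) if no \<open>C\<close> is admissible.\<close>

definition psi2_norm :: "'w measure \<Rightarrow> ('w \<Rightarrow> real) \<Rightarrow> ennreal" where
  "psi2_norm M Y =
     Inf {ennreal C | C. 0 < C \<and> (\<integral>\<^sup>+w. ennreal (exp ((Y w)\<^sup>2 / C\<^sup>2) - 1) \<partial>M) \<le> 1}"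

definition psi2_norm_vec :: "'w measure \<Rightarrow> ('w \<Rightarrow> real ^ 'd) \<Rightarrow> ennreal" where
  "psi2_norm_vec M X = (SUP v\<in>sphere 0 1. psi2_norm M (\<lambda>w. X w \<bullet> v))"

text \<open>The conjunct \<open>0 \<le> \<sigma>\<close> is needed because \<^const>\<open>ennreal\<close> maps negative numbers to 0.\<close>

definition sub_gaussian :: "real \<Rightarrow> (real ^ 'd \<Rightarrow> real) \<Rightarrow> bool" where
  "sub_gaussian \<sigma> p \<longleftrightarrow> 0 \<le> \<sigma> \<and> psi2_norm_vec (law p) (\<lambda>x. x) = ennreal \<sigma>"

definition gauss_density :: "real \<Rightarrow> real ^ 'd \<Rightarrow> real" where
  "gauss_density t x =
     (2 * pi * t) powr (- (real CARD('d) / 2)) * exp (- ((norm x)\<^sup>2 / (2 * t)))"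

definition smoothed :: "(real ^ 'd \<Rightarrow> real) \<Rightarrow> real \<Rightarrow> real ^ 'd \<Rightarrow> real" where
  "smoothed p t x = (\<integral>y. p y * gauss_density t (x - y) \<partial>lborel)"

definition gradient :: "(real ^ 'd \<Rightarrow> real) \<Rightarrow> real ^ 'd \<Rightarrow> real ^ 'd" where
  "gradient f x = (THE D. GDERIV f x :> D)"

definition score :: "(real ^ 'd \<Rightarrow> real) \<Rightarrow> real \<Rightarrow> real ^ 'd \<Rightarrow> real ^ 'd" where
  "score p t = gradient (\<lambda>y. ln (smoothed p t y))"

text \<open>A rule \<open>s\<close> maps the sample size \<open>n\<close>, the time \<open>t\<close>, the samples
  \<open>xs 0, \<dots>, xs (n - 1)\<close> and a random seed \<open>u\<close> to a function on the space. The seed has law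
  \<open>Q\<close>. A real-valued seed is general enough, since every standard Borel space is Borel
  isomorphic to a Borel subset of the line. Joint measurability, including in \<open>t\<close>, makes all
  the iterated integrals below meaningful.\<close>

type_synonym 'd score_rule =
  "nat \<Rightarrow> real \<Rightarrow> (nat \<Rightarrow> real ^ 'd) \<Rightarrow> real \<Rightarrow> real ^ 'd \<Rightarrow> real ^ 'd"

definition score_estimator :: "real measure \<Rightarrow> 'd::finite score_rule \<Rightarrow> bool" where
  "score_estimator Q s \<longleftrightarrow>
     prob_space Q \<and> sets Q = sets borel \<and>
     (\<forall>n\<ge>2. (\<lambda>(t, xs, u, x). s n t xs u x) \<in> borel_measurable
        (restrict_space borel {0<..} \<Otimes>\<^sub>M PiM {..<n} (\<lambda>_. borel) \<Otimes>\<^sub>M borel \<Otimes>\<^sub>M borel))"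

text \<open>The outer integral is the expectation over \<open>n\<close> independent samples from \<open>p\<close> and an
  independent seed.\<close>

definition score_risk ::
    "real measure \<Rightarrow> 'd::finite score_rule \<Rightarrow> (real ^ 'd \<Rightarrow> real) \<Rightarrow> nat \<Rightarrow> real \<Rightarrow> ennreal" where
  "score_risk Q s p n t =
     (\<integral>\<^sup>+(xs, u).
        (\<integral>\<^sup>+x. ennreal ((norm (s n t xs u x - score p t x))\<^sup>2 * smoothed p t x) \<partial>lborel)
      \<partial>(PiM {..<n} (\<lambda>_. law p) \<Otimes>\<^sub>M Q))"

definition integrated_risk ::
    "real measure \<Rightarrow> 'd::finite score_rule \<Rightarrow> (real ^ 'd \<Rightarrow> real) \<Rightarrow> nat \<Rightarrow> real \<Rightarrow> real \<Rightarrow> ennreal"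
  where
  "integrated_risk Q s p n t\<^sub>0 T = (\<integral>\<^sup>+t\<in>{t\<^sub>0..T}. score_risk Q s p n t \<partial>lborel)"

text \<open>\<open>f n \<lesssim> polylog(n) g n\<close>, where \<open>n\<close> ranges over the admissible sample sizes.\<close>

definition polylog_bounded :: "(nat \<Rightarrow> ennreal) \<Rightarrow> (nat \<Rightarrow> real) \<Rightarrow> bool" where
  "polylog_bounded f g \<longleftrightarrow>
     (\<exists>K>0. \<exists>C::real. \<forall>n\<ge>2. f n \<le> ennreal (K * ln (real n) powr C * g n))"

end

theory Submission
  imports Defs
begin

text \<open>The estimator is the score \<open>w\<close> of the Gaussian kernel density estimator with variance \<open>t\<close>, set
  to 0 where \<open>\<parallel>w\<parallel>\<^sup>2\<close> exceeds \<open>8 (1 + ln n) / t\<close>. Let \<open>c = (2 \<pi> t) powr (- d / 2)\<close> be the maximum of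
  the kernel. The kernel sums have variances at most \<open>c p\<^sub>t / n\<close> and \<open>c p\<^sub>t / (n t)\<close>. Where
  \<open>p\<^sub>t \<ge> c / n\<close> the threshold is at least four times \<open>\<parallel>s\<^sub>t\<parallel>\<^sup>2\<close>, and the event that the estimated
  density is below \<open>p\<^sub>t / 2\<close> costs no more than the variance, because there
  \<open>p\<^sub>t \<le> 4 (p - p\<^sub>t)\<^sup>2 / p\<^sub>t\<close> for the estimate \<open>p\<close>; so Chebyshev suffices and no exponential
  concentration is needed. Where \<open>p\<^sub>t < c / n\<close> the weight \<open>p\<^sub>t\<close> itself is small enough. Either way
  the expected weighted error at a point is at most \<open>88 (1 + ln n) c / (n t)\<close>. This is integrated
  over a ball whose squared radius is of order \<open>(1 + t) ln n\<close>; outside it the Gaussian moment of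
  \<open>p\<^sub>0\<close> gives \<open>O((1 + ln n) / (n t))\<close>. Integrating \<open>1 / t\<close> over \<open>t\<close> costs one more logarithm.\<close>

section \<open>The Gaussian kernel\<close>

text \<open>The tangent of exp at 1 gives \<open>exp 1 * x \<le> exp x\<close>, and
  \<open>exp 1 \<ge> 2\<close>. The factor 2 offsets the 2 in the exponent of the Gaussian
  kernel.\<close>

lemma exp_ge_double: "2 * x \<le> exp (x :: real)"
proof -
  have "exp 1 * x \<le> exp x"
    using exp_ge_add_one_self[of "x - 1"] by (simp add: exp_diff field_simps)
  moreover have "2 * x \<le> exp 1 * x" if "0 \<le> x"
    using exp_ge_add_one_self[of 1] that by (intro mult_right_mono) auto
  ultimately show ?thesis
    using exp_gt_zero[of x] by linarith
qed

text \<open>The type argument carries the dimension, which \<open>t\<close> alone would not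
  fix.\<close>

definition gauss_max :: "'d::finite itself \<Rightarrow> real \<Rightarrow> real" where
  "gauss_max _ t = (2 * pi * t) powr (- (real CARD('d) / 2))"

lemma gauss_max_pos: "0 < t \<Longrightarrow> 0 < gauss_max TYPE('d::finite) t"
  by (simp add: gauss_max_def)

lemma gauss_max_nonneg: "0 \<le> gauss_max TYPE('d::finite) t"
  by (simp add: gauss_max_def)

lemma gauss_density_eq:
  "gauss_density t (z :: real ^ 'd) = gauss_max TYPE('d) t * exp (- ((norm z)\<^sup>2 / (2 * t)))"
  by (simp add: gauss_density_def gauss_max_def)

lemma gauss_density_pos: "0 < t \<Longrightarrow> 0 < gauss_density t (z :: real ^ 'd::finite)"
  by (simp add: gauss_density_eq gauss_max_pos)

lemma gauss_density_nonneg: "0 \<le> gauss_density t (z :: real ^ 'd::finite)"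
  by (simp add: gauss_density_def)

lemma gauss_density_le:
  "0 < t \<Longrightarrow> gauss_density t (z :: real ^ 'd::finite) \<le> gauss_max TYPE('d) t"
  by (simp add: gauss_density_eq gauss_max_pos)

text \<open>With \<open>u\<close> the squared norm of \<open>z\<close> over \<open>2 * t\<close>
  this is \<open>2 * u * exp (- u) \<le> 1\<close>.\<close>

lemma gauss_density_sq_le:
  assumes "0 < t"
  shows "gauss_density t (z :: real ^ 'd::finite) * (norm z)\<^sup>2 / t \<le> gauss_max TYPE('d) t"
proof -
  have "(norm z)\<^sup>2 / t * exp (- ((norm z)\<^sup>2 / (2 * t))) \<le> 1"
    using mult_right_mono[OF exp_ge_double[of "(norm z)\<^sup>2 / (2 * t)"], of "exp (- ((norm z)\<^sup>2 / (2 * t)))"]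
    by (simp add: exp_add[symmetric])
  then have "gauss_max TYPE('d) t * ((norm z)\<^sup>2 / t * exp (- ((norm z)\<^sup>2 / (2 * t))))
      \<le> gauss_max TYPE('d) t * 1"
    by (intro mult_left_mono) (auto simp: gauss_max_pos assms less_imp_le)
  then show ?thesis by (simp add: gauss_density_eq mult_ac)
qed

lemma gauss_density_measurable [measurable (raw)]:
  assumes [measurable]: "f \<in> borel_measurable M" "g \<in> M \<rightarrow>\<^sub>M (borel :: (real ^ 'd) measure)"
  shows "(\<lambda>w. gauss_density (f w) (g w) :: real) \<in> borel_measurable M"
  unfolding gauss_density_def by measurable

text \<open>The vector is the gradient of the kernel in \<open>x\<close>. In its squared norm one
  kernel factor absorbs the squared distance by \<open>gauss_density_sq_le\<close>. The other is
  kept, so that integration over \<open>y\<close> yields a bound proportional to the smoothed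
  density.\<close>

lemma norm_gauss_gradient_le:
  fixes x y :: "real ^ 'd::finite"
  assumes "0 < t"
  shows "(norm ((gauss_density t (x - y) / t) *\<^sub>R (y - x)))\<^sup>2 \<le>
      gauss_max TYPE('d) t / t * gauss_density t (x - y)"
proof -
  have "(norm ((gauss_density t (x - y) / t) *\<^sub>R (y - x)))\<^sup>2 =
      gauss_density t (x - y) * (norm (x - y))\<^sup>2 / t * (gauss_density t (x - y) / t)"
    by (simp add: power_mult_distrib power2_eq_square norm_minus_commute)
  also have "\<dots> \<le> gauss_max TYPE('d) t * (gauss_density t (x - y) / t)"
    using assms by (intro mult_right_mono gauss_density_sq_le) (auto intro!: divide_nonneg_pos gauss_density_nonneg)
  finally show ?thesis by simp
qed

text \<open>Second-order Taylor expansion along the segment from \<open>x\<close> to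
  \<open>x + h\<close>. The remainder is uniform in \<open>y\<close>, so the estimate can be
  integrated over the data point, which replaces a dominated convergence argument.\<close>

lemma gauss_density_taylor:
  fixes x y h :: "real ^ 'd::finite"
  assumes t: "0 < t"
  shows "\<bar>gauss_density t (x + h - y) - gauss_density t (x - y)
      - h \<bullet> ((gauss_density t (x - y) / t) *\<^sub>R (y - x))\<bar> \<le> gauss_max TYPE('d) t / t * (norm h)\<^sup>2"
proof -
  define z where "z = x - y"
  define w where "w r = z + r *\<^sub>R h" for r :: real
  \<comment> \<open>The derivatives of order 0, 1 and 2 of the kernel along the segment.\<close>
  define D where "D m r = (if m = 0 then gauss_density t (w r)
      else if m = 1 then - (w r \<bullet> h) / t * gauss_density t (w r)
      else ((w r \<bullet> h)\<^sup>2 / t\<^sup>2 - (h \<bullet> h) / t) * gauss_density t (w r))" for m :: nat and r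
  have w_alt: "(norm (w r))\<^sup>2 = z \<bullet> z + 2 * r * (z \<bullet> h) + r\<^sup>2 * (h \<bullet> h)" for r
    unfolding power2_norm_eq_inner
    by (simp add: w_def inner_add inner_commute power2_eq_square algebra_simps)
  have w_inner: "w r \<bullet> h = z \<bullet> h + r * (h \<bullet> h)" for r
    by (simp add: w_def inner_add)
  have d0: "((\<lambda>r. gauss_density t (w r)) has_real_derivative
      - (w r \<bullet> h) / t * gauss_density t (w r)) (at r)" for r
    unfolding gauss_density_eq w_alt w_inner using t
    by (auto intro!: derivative_eq_intros simp: field_simps)
  have d1: "((\<lambda>r. - (w r \<bullet> h) / t * gauss_density t (w r)) has_real_derivative
      ((w r \<bullet> h)\<^sup>2 / t\<^sup>2 - (h \<bullet> h) / t) * gauss_density t (w r)) (at r)" for r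
  proof -
    have "((\<lambda>r. - (w r \<bullet> h) / t) has_real_derivative - (h \<bullet> h) / t) (at r)"
      unfolding w_inner using t by (auto intro!: derivative_eq_intros)
    from DERIV_mult[OF this d0] show ?thesis
      by (simp add: algebra_simps power2_eq_square)
  qed
  have "\<exists>r. 0 < r \<and> r \<le> 1 \<and> D 0 1 = (\<Sum>m<2. D m 0 / fact m * 1 ^ m) + D 2 r / fact 2 * 1 ^ 2"
  proof (rule Maclaurin2[where diff = D])
    show "\<forall>m r. m < 2 \<and> 0 \<le> r \<and> r \<le> 1 \<longrightarrow> DERIV (D m) r :> D (Suc m) r"
      using d0 d1 by (auto simp: less_2_cases_iff D_def[abs_def])
  qed auto
  then obtain r where r: "D 0 1 = D 0 0 + D 1 0 + D 2 r / 2"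
    by (auto simp: numeral_2_eq_2)
  have "\<bar>D 2 r\<bar> \<le> ((w r \<bullet> h)\<^sup>2 / t\<^sup>2 + (h \<bullet> h) / t) * gauss_density t (w r)"
    unfolding D_def using t
    by (simp add: abs_mult gauss_density_nonneg)
       (intro mult_right_mono gauss_density_nonneg, auto intro: order.trans[OF abs_triangle_ineq4])
  also have "\<dots> \<le> (((norm (w r))\<^sup>2 * (norm h)\<^sup>2) / t\<^sup>2 + (norm h)\<^sup>2 / t) * gauss_density t (w r)"
    using t by (intro mult_right_mono add_mono divide_right_mono gauss_density_nonneg)
      (auto simp: power2_norm_eq_inner Cauchy_Schwarz_ineq)
  also have "\<dots> = (norm h)\<^sup>2 / t * (gauss_density t (w r) * (norm (w r))\<^sup>2 / t + gauss_density t (w r))"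
    by (simp add: algebra_simps power2_eq_square)
  \<comment> \<open>Each summand is at most the maximum of the kernel. The resulting factor 2
    cancels against the Taylor coefficient 1/2.\<close>
  also have "\<dots> \<le> (norm h)\<^sup>2 / t * (gauss_max TYPE('d) t + gauss_max TYPE('d) t)"
    using t by (intro mult_left_mono add_mono gauss_density_sq_le gauss_density_le) auto
  finally have "\<bar>D 2 r / 2\<bar> \<le> gauss_max TYPE('d) t / t * (norm h)\<^sup>2"
    by (simp add: mult_ac)
  moreover have "D 0 1 - D 0 0 - D 1 0 = gauss_density t (x + h - y) - gauss_density t (x - y)
      - h \<bullet> ((gauss_density t (x - y) / t) *\<^sub>R (y - x))"
  proof -
    have z: "x + h - y = z + h" "y - x = - z" by (simp_all add: z_def)
    show ?thesis
      unfolding z by (simp add: D_def w_def inner_commute z_def[symmetric] mult.commute)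
  qed
  moreover have "D 0 1 - D 0 0 - D 1 0 = D 2 r / 2" using r by linarith
  ultimately show ?thesis by metis
qed

section \<open>Tools from calculus and integration\<close>

lemma has_derivative_quadraticI:
  fixes f :: "'a::real_normed_vector \<Rightarrow> 'b::real_normed_vector"
  assumes "bounded_linear D" and le: "\<And>h. norm (f (x + h) - f x - D h) \<le> K * (norm h)\<^sup>2"
  shows "(f has_derivative D) (at x)"
  unfolding has_derivative_at
proof (intro conjI assms(1))
  show "(\<lambda>h. norm (f (x + h) - f x - D h) / norm h) \<midarrow>0\<rightarrow> 0"
  proof (rule tendsto_sandwich[where f = "\<lambda>_. 0" and h = "\<lambda>h. K * norm h"])
    show "\<forall>\<^sub>F h in at 0. norm (f (x + h) - f x - D h) / norm h \<le> K * norm h"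
      unfolding eventually_at_filter
      using le by (auto simp: divide_le_eq power2_eq_square mult_ac)
    show "(\<lambda>h. K * norm h) \<midarrow>0\<rightarrow> 0"
      by (rule tendsto_eq_intros | simp)+
  qed auto
qed

lemma norm_sq_eq_sum_Basis: "(norm v)\<^sup>2 = (\<Sum>b\<in>Basis. (v \<bullet> b)\<^sup>2)" for v :: "'a::euclidean_space"
  unfolding power2_norm_eq_inner using euclidean_inner[of v v] by (simp add: power2_eq_square)

text \<open>The kernel is the product over the coordinates of one-dimensional normal densities with
  standard deviation \<open>sqrt t\<close>, so the integral factors.\<close>

lemma nn_integral_gauss_density:
  assumes t: "0 < t"
  shows "(\<integral>\<^sup>+x. ennreal (gauss_density t (x :: real ^ 'd::finite)) \<partial>lborel) = 1"
proof -
  have "gauss_density t x = (\<Prod>b\<in>Basis. normal_density 0 (sqrt t) (x \<bullet> b))" for x :: "real ^ 'd"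
  proof -
    have "(2 * pi * t) powr (- (real CARD('d) / 2)) = (1 / sqrt (2 * pi * t)) ^ CARD('d)"
      using t by (simp add: powr_minus powr_half_sqrt[symmetric] powr_powr
          powr_realpow[symmetric] power_one_over field_simps powr_divide)
    then show ?thesis
      using t by (simp add: norm_sq_eq_sum_Basis gauss_density_def normal_density_def prod.distrib exp_sum[symmetric]
          sum_negf[symmetric] sum_divide_distrib prod_dividef power_one_over)
  qed
  moreover have "(\<integral>\<^sup>+u. ennreal (normal_density 0 (sqrt t) u) \<partial>lborel) = 1"
    using prob_space.emeasure_space_1[OF prob_space_normal_density[of "sqrt t" 0]] t
    by (simp add: emeasure_density)
  ultimately show ?thesis
    using nn_integral_lborel_prod[where f = "\<lambda>(_ :: real ^ 'd) u. ennreal (normal_density 0 (sqrt t) u)"]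
    by (simp add: prod_ennreal)
qed

lemma nn_integral_lborel_shift:
  fixes c :: "'a::euclidean_space"
  assumes [measurable]: "f \<in> borel_measurable borel"
  shows "(\<integral>\<^sup>+x. f (x - c) \<partial>lborel) = (\<integral>\<^sup>+x. f x \<partial>lborel)"
proof -
  have "(\<integral>\<^sup>+x. f x \<partial>lborel) = (\<integral>\<^sup>+x. f x \<partial>distr lborel borel ((+) (- c)))"
    by (simp only: lborel_distr_plus)
  also have "\<dots> = (\<integral>\<^sup>+x. f (x - c) \<partial>lborel)"
    by (subst nn_integral_distr) auto
  finally show ?thesis ..
qed

section \<open>Mean square deviation of sample means\<close>

text \<open>The variance of a mean of independent copies: after centering, the off-diagonal products
  have expectation 0 and the \<open>n\<close> diagonal ones are divided by the square of
  \<open>n\<close>. The variance is then bounded by the second moment, which is easier to estimate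
  for kernels.\<close>

lemma (in prob_space) nn_integral_square_mean_deviation_le:
  fixes f :: "'a \<Rightarrow> real"
  assumes [measurable]: "f \<in> borel_measurable M"
    and bnd: "\<And>x. x \<in> space M \<Longrightarrow> \<bar>f x\<bar> \<le> K" and n: "0 < n"
  shows "(\<integral>\<^sup>+w. ennreal (((\<Sum>i<n. f (w i)) / real n - expectation f)\<^sup>2) \<partial>PiM {..<n} (\<lambda>_. M))
    \<le> ennreal (expectation (\<lambda>x. (f x)\<^sup>2) / real n)"
proof -
  interpret P: prob_space "PiM {..<n} (\<lambda>_. M)"
    by (intro prob_space_PiM prob_space_axioms)
  interpret PS: product_sigma_finite "\<lambda>_ :: nat. M" ..
  define g where "g = (\<lambda>x. f x - expectation f)"
  have [measurable]: "g \<in> borel_measurable M" unfolding g_def by measurable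
  have f_int: "integrable M f"
    using bnd by (intro integrable_const_bound[where B = K] AE_I2) auto
  have f2_int: "integrable M (\<lambda>x. (f x)\<^sup>2)"
  proof (intro integrable_const_bound[where B = "K\<^sup>2"] AE_I2)
    show "norm ((f x)\<^sup>2) \<le> K\<^sup>2" if "x \<in> space M" for x
      using power_mono[OF bnd[OF that], of 2] by simp
  qed auto
  have g_int: "integrable M g"
    unfolding g_def using f_int by auto
  have g0: "expectation g = 0"
    using f_int by (simp add: g_def prob_space)
  have g2_int: "integrable M (\<lambda>x. (g x)\<^sup>2)"
    unfolding g_def power2_diff using f_int f2_int by auto
  have g2: "expectation (\<lambda>x. (g x)\<^sup>2) \<le> expectation (\<lambda>x. (f x)\<^sup>2)"
    unfolding g_def by (subst variance_eq[OF f_int f2_int]) auto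
  have single: "integrable (PiM {..<n} (\<lambda>_. M)) (\<lambda>w. h (w i))"
      "P.expectation (\<lambda>w. h (w i)) = expectation h"
    if [measurable]: "integrable M h" and "i < n" for h :: "'a \<Rightarrow> real" and i
  proof -
    have d: "distr (PiM {..<n} (\<lambda>_. M)) M (\<lambda>w. w i) = M"
      using that by (intro distr_PiM_component prob_space_axioms) auto
    have [measurable]: "(\<lambda>w. w i) \<in> PiM {..<n} (\<lambda>_. M) \<rightarrow>\<^sub>M M"
      using that by (intro measurable_component_singleton) auto
    have [measurable]: "h \<in> borel_measurable M" using that by auto
    show "integrable (PiM {..<n} (\<lambda>_. M)) (\<lambda>w. h (w i))"
      by (rule integrable_distr[where M' = M]) (simp_all add: d that)
    show "P.expectation (\<lambda>w. h (w i)) = expectation h"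
      by (subst (2) d[symmetric]) (simp add: integral_distr)
  qed
  have prods: "integrable (PiM {..<n} (\<lambda>_. M)) (\<lambda>w. g (w i) * g (w j)) \<and>
      P.expectation (\<lambda>w. g (w i) * g (w j)) = (if i = j then expectation (\<lambda>x. (g x)\<^sup>2) else 0)"
    if ij: "i < n" "j < n" for i j
  proof (cases "i = j")
    case True
    then show ?thesis
      using single[OF g2_int] ij by (simp add: power2_eq_square)
  next
    case False
    \<comment> \<open>The product of two coordinates is padded with the constant 1 to a product over
      all coordinates, so that the integral factors. The factor at \<open>i\<close> is then the mean
      of \<open>g\<close>, which is 0.\<close>
    have G: "(\<Prod>k<n. (if k = i \<or> k = j then g else (\<lambda>_. 1)) (w k)) = g (w i) * g (w j)" for w
    proof -
      have "(\<Prod>k<n. (if k = i \<or> k = j then g else (\<lambda>_. 1)) (w k))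
          = (\<Prod>k\<in>{i, j}. (if k = i \<or> k = j then g else (\<lambda>_. 1)) (w k))"
        using ij by (intro prod.mono_neutral_right) auto
      then show ?thesis using False by simp
    qed
    have "integrable (PiM {..<n} (\<lambda>_. M)) (\<lambda>w. \<Prod>k<n. (if k = i \<or> k = j then g else (\<lambda>_. 1)) (w k))"
      using g_int by (intro PS.product_integrable_prod) auto
    moreover have "P.expectation (\<lambda>w. \<Prod>k<n. (if k = i \<or> k = j then g else (\<lambda>_. 1)) (w k))
        = (\<Prod>k<n. expectation (if k = i \<or> k = j then g else (\<lambda>_. 1)))"
      using g_int by (intro PS.product_integral_prod) auto
    moreover have "(\<Prod>k<n. expectation (if k = i \<or> k = j then g else (\<lambda>_. 1))) = 0"
      using ij g0 by (intro prod_zero) auto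
    ultimately show ?thesis using False unfolding G by simp
  qed
  have eq: "((\<Sum>i<n. f (w i)) / real n - expectation f)\<^sup>2
      = (\<Sum>i<n. \<Sum>j<n. g (w i) * g (w j)) / (real n)\<^sup>2" for w
  proof -
    have "(\<Sum>i<n. f (w i)) / real n - expectation f = (\<Sum>i<n. g (w i)) / real n"
      using n by (simp add: g_def sum_subtractf field_simps)
    then show ?thesis
      by (simp add: power_divide power2_eq_square sum_product)
  qed
  have "integrable (PiM {..<n} (\<lambda>_. M)) (\<lambda>w. (\<Sum>i<n. \<Sum>j<n. g (w i) * g (w j)) / (real n)\<^sup>2)"
    using prods by (intro integrable_divide Bochner_Integration.integrable_sum) auto
  then have "(\<integral>\<^sup>+w. ennreal (((\<Sum>i<n. f (w i)) / real n - expectation f)\<^sup>2) \<partial>PiM {..<n} (\<lambda>_. M))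
      = ennreal (P.expectation (\<lambda>w. (\<Sum>i<n. \<Sum>j<n. g (w i) * g (w j)) / (real n)\<^sup>2))"
    unfolding eq by (intro nn_integral_eq_integral) (auto simp: eq[symmetric])
  also have "P.expectation (\<lambda>w. (\<Sum>i<n. \<Sum>j<n. g (w i) * g (w j)) / (real n)\<^sup>2)
      = (\<Sum>i<n. \<Sum>j<n. if i = j then expectation (\<lambda>x. (g x)\<^sup>2) else 0) / (real n)\<^sup>2"
  proof -
    have "P.expectation (\<lambda>w. \<Sum>i<n. \<Sum>j<n. g (w i) * g (w j))
        = (\<Sum>i<n. P.expectation (\<lambda>w. \<Sum>j<n. g (w i) * g (w j)))"
      using prods by (intro Bochner_Integration.integral_sum Bochner_Integration.integrable_sum) auto
    also have "\<dots> = (\<Sum>i<n. \<Sum>j<n. P.expectation (\<lambda>w. g (w i) * g (w j)))"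
      using prods by (intro sum.cong refl Bochner_Integration.integral_sum) auto
    also have "\<dots> = (\<Sum>i<n. \<Sum>j<n. if i = j then expectation (\<lambda>x. (g x)\<^sup>2) else 0)"
      using prods by (intro sum.cong refl) auto
    finally show ?thesis by (simp only: integral_divide_zero)
  qed
  also have "\<dots> = expectation (\<lambda>x. (g x)\<^sup>2) / real n"
    by (simp add: power2_eq_square)
  also have "\<dots> \<le> expectation (\<lambda>x. (f x)\<^sup>2) / real n"
    using g2 by (intro divide_right_mono) auto
  finally show ?thesis by (simp add: ennreal_leI)
qed

text \<open>The scalar bound is summed over an orthonormal basis. The second moments of the
  coordinates add up to that of the norm, so no factor of the dimension appears.\<close>

lemma (in prob_space) nn_integral_square_mean_deviation_vec_le:
  fixes F :: "'a \<Rightarrow> 'b::euclidean_space"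
  assumes [measurable]: "F \<in> borel_measurable M"
    and bnd: "\<And>x. x \<in> space M \<Longrightarrow> norm (F x) \<le> K" and n: "0 < n"
  shows "(\<integral>\<^sup>+w. ennreal ((norm ((1 / real n) *\<^sub>R (\<Sum>i<n. F (w i)) - expectation F))\<^sup>2) \<partial>PiM {..<n} (\<lambda>_. M))
    \<le> ennreal (expectation (\<lambda>x. (norm (F x))\<^sup>2) / real n)"
proof -
  have F_int: "integrable M F"
    using bnd by (intro integrable_const_bound[where B = K] AE_I2) auto
  have bnd': "\<bar>F x \<bullet> b\<bar> \<le> K" if "x \<in> space M" "b \<in> Basis" for x b
    using bnd[OF that(1)] Basis_le_norm[OF that(2), of "F x"] by linarith
  have [simp]: "integrable M (\<lambda>x. (F x \<bullet> b)\<^sup>2)" if "b \<in> Basis" for b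
  proof (intro integrable_const_bound[where B = "K\<^sup>2"] AE_I2)
    show "norm ((F x \<bullet> b)\<^sup>2) \<le> K\<^sup>2" if "x \<in> space M" for x
      using power_mono[OF bnd'[OF that \<open>b \<in> Basis\<close>], of 2] by simp
  qed auto
  have "((1 / real n) *\<^sub>R (\<Sum>i<n. F (w i)) - expectation F) \<bullet> b =
      (\<Sum>i<n. F (w i) \<bullet> b) / real n - expectation (\<lambda>x. F x \<bullet> b)" if "b \<in> Basis" for w b
    using F_int by (simp add: inner_diff_left inner_sum_left)
  then have "(\<integral>\<^sup>+w. ennreal ((norm ((1 / real n) *\<^sub>R (\<Sum>i<n. F (w i)) - expectation F))\<^sup>2) \<partial>PiM {..<n} (\<lambda>_. M))
      = (\<integral>\<^sup>+w. (\<Sum>b\<in>Basis. ennreal (((\<Sum>i<n. F (w i) \<bullet> b) / real n - expectation (\<lambda>x. F x \<bullet> b))\<^sup>2))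
          \<partial>PiM {..<n} (\<lambda>_. M))"
    by (simp add: norm_sq_eq_sum_Basis)
  also have "\<dots> = (\<Sum>b\<in>Basis. \<integral>\<^sup>+w. ennreal (((\<Sum>i<n. F (w i) \<bullet> b) / real n - expectation (\<lambda>x. F x \<bullet> b))\<^sup>2)
          \<partial>PiM {..<n} (\<lambda>_. M))"
    by (rule nn_integral_sum) measurable
  also have "\<dots> \<le> (\<Sum>b\<in>Basis. ennreal (expectation (\<lambda>x. (F x \<bullet> b)\<^sup>2) / real n))"
    using bnd' n by (intro sum_mono nn_integral_square_mean_deviation_le) auto
  also have "\<dots> = ennreal (expectation (\<lambda>x. (norm (F x))\<^sup>2) / real n)"
    by (simp add: norm_sq_eq_sum_Basis sum_divide_distrib)
  finally show ?thesis .
qed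

section \<open>Deterministic error of a truncated ratio\<close>

lemma norm_diff_sq_le:
  fixes a b :: "'a::real_inner"
  shows "(norm (a - b))\<^sup>2 \<le> 2 * (norm a)\<^sup>2 + 2 * (norm b)\<^sup>2"
  using zero_le_power2[of "norm (a + b)"]
  unfolding power2_norm_eq_inner by (auto simp: inner_add inner_diff inner_commute)

text \<open>If \<open>ph < p / 2\<close>, truncation bounds the error, and \<open>p\<close> itself
  is controlled by the deviation of \<open>ph\<close>. Otherwise dividing by \<open>ph\<close> costs
  at most a factor 2, and the error of the ratio is linear in the deviations of numerator and
  denominator. The first case produces the constant 40, the second both constants 8.\<close>

lemma ratio_deviation_bound:
  fixes g gh v :: "'a::real_inner"
  assumes p: "0 < p" and B: "(norm ((1 / p) *\<^sub>R g))\<^sup>2 \<le> B"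
    and v: "v = (let w = (1 / ph) *\<^sub>R gh in if (norm w)\<^sup>2 \<le> 4 * B then w else 0)"
  shows "(norm (v - (1 / p) *\<^sub>R g))\<^sup>2 * p \<le> 40 * B * ((ph - p)\<^sup>2 / p) + 8 * ((norm (gh - g))\<^sup>2 / p)"
proof -
  define s where "s = (1 / p) *\<^sub>R g"
  define w where "w = (1 / ph) *\<^sub>R gh"
  have sB: "(norm s)\<^sup>2 \<le> B" using B by (simp add: s_def)
  then have B0: "0 \<le> B" by (rule order.trans[rotated]) simp
  have v': "v = (if (norm w)\<^sup>2 \<le> 4 * B then w else 0)"
    using v by (simp add: w_def Let_def)
  show ?thesis
  proof (cases "ph < p / 2")
    case True
    \<comment> \<open>The constant is 2 * 4 + 2, from the threshold \<open>4 * B\<close> for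
      \<open>v\<close> and the bound \<open>B\<close> for \<open>s\<close>.\<close>
    have "(norm (v - s))\<^sup>2 \<le> 10 * B"
      using norm_diff_sq_le[of v s] sB B0 by (auto simp: v' split: if_splits)
    moreover have "p \<le> 4 * ((ph - p)\<^sup>2 / p)"
    proof -
      have "(p / 2)\<^sup>2 \<le> (p - ph)\<^sup>2" using True p by (intro power_mono) auto
      then show ?thesis using p by (simp add: field_simps power2_eq_square)
    qed
    ultimately have "(norm (v - s))\<^sup>2 * p \<le> 10 * B * (4 * ((ph - p)\<^sup>2 / p))"
      using p B0 by (intro mult_mono) auto
    moreover have "0 \<le> (norm (gh - g))\<^sup>2 / p" using p by simp
    ultimately show ?thesis unfolding s_def[symmetric] by linarith
  next
    case False
    then have ph: "p / 2 \<le> ph" "0 < ph" using p by auto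
    have vw: "norm (v - s) \<le> norm (w - s)"
    proof (cases "(norm w)\<^sup>2 \<le> 4 * B")
      case False
      \<comment> \<open>This is why the threshold is four times \<open>B\<close>: a discarded
        \<open>w\<close> has more than twice the norm of \<open>s\<close>, so its replacement 0 lies
        closer to \<open>s\<close> than \<open>w\<close> does.\<close>
      then have "(2 * norm s)\<^sup>2 < (norm w)\<^sup>2" using sB by (simp add: power_mult_distrib)
      then have "2 * norm s < norm w" by (rule power_less_imp_less_base) simp
      then show ?thesis using False norm_triangle_ineq2[of w s] by (simp add: v')
    qed (simp add: v')
    have "ph *\<^sub>R (w - s) = (gh - g) - (ph - p) *\<^sub>R s"
      using ph p by (simp add: w_def s_def scaleR_diff_right scaleR_diff_left diff_divide_distrib)
    then have "ph\<^sup>2 * (norm (w - s))\<^sup>2 = (norm ((gh - g) - (ph - p) *\<^sub>R s))\<^sup>2"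
      by (simp add: power_mult_distrib flip: \<open>ph *\<^sub>R (w - s) = (gh - g) - (ph - p) *\<^sub>R s\<close>)
    also have "\<dots> \<le> 2 * (norm (gh - g))\<^sup>2 + 2 * ((ph - p)\<^sup>2 * (norm s)\<^sup>2)"
      using norm_diff_sq_le[of "gh - g" "(ph - p) *\<^sub>R s"] by (simp add: power_mult_distrib)
    also have "\<dots> \<le> 2 * (norm (gh - g))\<^sup>2 + 2 * ((ph - p)\<^sup>2 * B)"
      using sB by (intro add_left_mono mult_left_mono) auto
    finally have 1: "ph\<^sup>2 * (norm (w - s))\<^sup>2 \<le> 2 * (norm (gh - g))\<^sup>2 + 2 * ((ph - p)\<^sup>2 * B)" .
    have "(p / 2)\<^sup>2 * (norm (v - s))\<^sup>2 \<le> ph\<^sup>2 * (norm (w - s))\<^sup>2"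
      using ph p vw by (intro mult_mono power_mono) auto
    with 1 have "p\<^sup>2 * (norm (v - s))\<^sup>2 \<le> 8 * (norm (gh - g))\<^sup>2 + 8 * ((ph - p)\<^sup>2 * B)"
      by (simp add: power_divide)
    then have "(norm (v - s))\<^sup>2 * p \<le> 8 * B * ((ph - p)\<^sup>2 / p) + 8 * ((norm (gh - g))\<^sup>2 / p)"
      using p by (simp add: field_simps power2_eq_square)
    moreover have "0 \<le> B * ((ph - p)\<^sup>2 / p)" using p B0 by simp
    ultimately show ?thesis unfolding s_def[symmetric] by linarith
  qed
qed

section \<open>Kernel estimators and Gaussian smoothing\<close>

definition kde :: "nat \<Rightarrow> real \<Rightarrow> (nat \<Rightarrow> real ^ 'd::finite) \<Rightarrow> real ^ 'd \<Rightarrow> real" where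
  "kde n t xs x = (\<Sum>i<n. gauss_density t (x - xs i)) / real n"

definition kde_grad :: "nat \<Rightarrow> real \<Rightarrow> (nat \<Rightarrow> real ^ 'd::finite) \<Rightarrow> real ^ 'd \<Rightarrow> real ^ 'd" where
  "kde_grad n t xs x = (1 / real n) *\<^sub>R (\<Sum>i<n. (gauss_density t (x - xs i) / t) *\<^sub>R (xs i - x))"

text \<open>The threshold is written as \<open>4 * B\<close> to match
  \<open>ratio_deviation_bound\<close>. Here \<open>B\<close> bounds the squared norm of the true
  score wherever the smoothed density is at least \<open>gauss_max\<close> divided by
  \<open>n\<close>.\<close>

definition kde_score :: "'d::finite score_rule" where
  "kde_score n t xs u x =
     (let w = (1 / kde n t xs x) *\<^sub>R kde_grad n t xs x
      in if (norm w)\<^sup>2 \<le> 4 * (2 * (1 + ln (real n)) / t) then w else 0)"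

text \<open>Measurability of the samples is asked only componentwise, so the lemma serves both the
  product of Borel spaces in \<open>score_estimator\<close> and the product of copies of \<mu>. The
  time may vary as well, as joint measurability requires.\<close>

lemma kde_score_measurable:
  fixes X :: "'a \<Rightarrow> real ^ 'd::finite"
  assumes [measurable]: "T \<in> borel_measurable M" "X \<in> borel_measurable M"
    and XS: "\<And>i. i < n \<Longrightarrow> (\<lambda>w. XS w i) \<in> borel_measurable M"
  shows "(\<lambda>w. kde_score n (T w) (XS w) (U w) (X w)) \<in> borel_measurable M"
proof -
  have [measurable]: "(\<lambda>w. kde n (T w) (XS w) (X w)) \<in> borel_measurable M"
    unfolding kde_def by (intro borel_measurable_divide borel_measurable_sum) (use XS in measurable)
  have [measurable]: "(\<lambda>w. kde_grad n (T w) (XS w) (X w)) \<in> borel_measurable M"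
    unfolding kde_grad_def by (intro borel_measurable_scaleR borel_measurable_sum) (use XS in measurable)
  show ?thesis
    unfolding kde_score_def Let_def by measurable
qed

lemma norm_kde_score_le:
  "0 < n \<Longrightarrow> 0 < t \<Longrightarrow> (norm (kde_score n t xs u x))\<^sup>2 \<le> 4 * (2 * (1 + ln (real n)) / t)"
  by (auto simp: kde_score_def Let_def)

section \<open>Smoothing of an arbitrary Borel law at a fixed time\<close>

locale gauss_smoothing = prob_space \<mu> for \<mu> :: "(real ^ 'd::finite) measure" +
  fixes t :: real
  assumes sets_\<mu> [measurable_cong]: "sets \<mu> = sets borel" and t: "0 < t"
begin

definition dens :: "real ^ 'd \<Rightarrow> real" where
  "dens x = (\<integral>y. gauss_density t (x - y) \<partial>\<mu>)"

definition grad :: "real ^ 'd \<Rightarrow> real ^ 'd" where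
  "grad x = (\<integral>y. (gauss_density t (x - y) / t) *\<^sub>R (y - x) \<partial>\<mu>)"

text \<open>Divided by \<open>dens x\<close>, this is the posterior mean of the squared distance
  over \<open>t\<close>, given that the data point plus Gaussian noise of variance \<open>t\<close>
  equals \<open>x\<close>.\<close>

definition sq :: "real ^ 'd \<Rightarrow> real" where
  "sq x = (\<integral>y. gauss_density t (x - y) * (norm (x - y))\<^sup>2 / t \<partial>\<mu>)"

lemma norm_gauss_gradient_le_const:
  "norm ((gauss_density t (x - y) / t) *\<^sub>R (y - x :: real ^ 'd)) \<le> sqrt (gauss_max TYPE('d) t / t * gauss_max TYPE('d) t)"
proof (rule real_le_rsqrt)
  have "gauss_max TYPE('d) t / t * gauss_density t (x - y) \<le> gauss_max TYPE('d) t / t * gauss_max TYPE('d) t"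
    using gauss_density_le[OF t, of "x - y"] gauss_max_pos[OF t, where 'd = 'd] t by (intro mult_left_mono) auto
  then show "(norm ((gauss_density t (x - y) / t) *\<^sub>R (y - x)))\<^sup>2 \<le> gauss_max TYPE('d) t / t * gauss_max TYPE('d) t"
    using norm_gauss_gradient_le[OF t, of x y] by linarith
qed

lemma integrable_gauss [simp]: "integrable \<mu> (\<lambda>y. gauss_density t (x - y))"
  by (intro integrable_const_bound[where B = "gauss_max TYPE('d) t"] AE_I2)
    (auto simp: gauss_density_le[OF t] gauss_density_nonneg)

lemma integrable_gauss_sq [simp]: "integrable \<mu> (\<lambda>y. gauss_density t (x - y) * (norm (x - y))\<^sup>2 / t)"
proof (intro integrable_const_bound[where B = "gauss_max TYPE('d) t"] AE_I2)
  show "norm (gauss_density t (x - y) * (norm (x - y))\<^sup>2 / t) \<le> gauss_max TYPE('d) t" for y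
    using gauss_density_sq_le[OF t, of "x - y"] t gauss_density_nonneg[of t "x - y"] by simp
qed measurable

lemma integrable_gauss_grad [simp]: "integrable \<mu> (\<lambda>y. (gauss_density t (x - y) / t) *\<^sub>R (y - x))"
  by (intro integrable_const_bound[OF AE_I2[OF norm_gauss_gradient_le_const]]) measurable

lemma dens_pos: "0 < dens x"
proof -
  have "(\<integral>y. 0 \<partial>\<mu>) < dens x"
    unfolding dens_def
    by (rule integral_less_AE_space) (auto simp: gauss_density_pos[OF t] emeasure_space_1)
  then show ?thesis by simp
qed

lemma dens_measurable [measurable]: "dens \<in> borel_measurable borel"
  unfolding dens_def[abs_def] by (rule borel_measurable_lebesgue_integral) measurable

lemma grad_measurable [measurable]: "grad \<in> borel_measurable borel"
  unfolding grad_def[abs_def] by (rule borel_measurable_lebesgue_integral) measurable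

lemma sq_measurable [measurable]: "sq \<in> borel_measurable borel"
  unfolding sq_def[abs_def] by (rule borel_measurable_lebesgue_integral) measurable

text \<open>The Taylor bound for the kernel is uniform in the data point, so its integral over the
  probability measure \<mu> is again a quadratic remainder.\<close>

lemma GDERIV_dens: "GDERIV dens x :> grad x"
  unfolding gderiv_def
proof (rule has_derivative_quadraticI)
  show "bounded_linear (\<lambda>h. h \<bullet> grad x)" by (rule bounded_linear_inner_left)
  show "norm (dens (x + h) - dens x - h \<bullet> grad x) \<le> gauss_max TYPE('d) t / t * (norm h)\<^sup>2" for h
  proof -
    have "dens (x + h) - dens x - h \<bullet> grad x = (\<integral>y. gauss_density t (x + h - y) - gauss_density t (x - y)
      - h \<bullet> ((gauss_density t (x - y) / t) *\<^sub>R (y - x)) \<partial>\<mu>)"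
      unfolding dens_def grad_def
      by (simp only: integrable_gauss integrable_gauss_grad Bochner_Integration.integral_diff
          Bochner_Integration.integrable_diff integrable_inner_right integral_inner_right)
    also have "norm \<dots> \<le> (\<integral>y. gauss_max TYPE('d) t / t * (norm h)\<^sup>2 \<partial>\<mu>)"
    proof (intro Bochner_Integration.integral_norm_bound_integral)
      show "norm (gauss_density t (x + h - y) - gauss_density t (x - y)
        - h \<bullet> ((gauss_density t (x - y) / t) *\<^sub>R (y - x))) \<le> gauss_max TYPE('d) t / t * (norm h)\<^sup>2" for y
        unfolding real_norm_def by (rule gauss_density_taylor[OF t])
    qed (auto intro!: Bochner_Integration.integrable_diff integrable_inner_right
        simp del: inner_scaleR_right)
    also have "\<dots> = gauss_max TYPE('d) t / t * (norm h)\<^sup>2" by (simp add: prob_space)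
    finally show ?thesis .
  qed
qed

lemma gradient_ln_dens: "gradient (\<lambda>y. ln (dens y)) x = (1 / dens x) *\<^sub>R grad x"
proof -
  have D: "GDERIV (\<lambda>y. ln (dens y)) x :> (1 / dens x) *\<^sub>R grad x"
    using GDERIV_DERIV_compose[OF GDERIV_dens DERIV_ln[OF dens_pos]] by (simp add: inverse_eq_divide)
  show ?thesis
    unfolding gradient_def
  proof (rule the_equality)
    show "GDERIV (\<lambda>y. ln (dens y)) x :> (1 / dens x) *\<^sub>R grad x" by (rule D)
    \<comment> \<open>Uniqueness is needed because \<open>gradient\<close> is a definite
      description.\<close>
    fix E assume "GDERIV (\<lambda>y. ln (dens y)) x :> E"
    with D have "(\<lambda>h. h \<bullet> ((1 / dens x) *\<^sub>R grad x)) = (\<lambda>h. h \<bullet> E)"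
      unfolding gderiv_def by (rule has_derivative_unique)
    then show "E = (1 / dens x) *\<^sub>R grad x"
      by (metis vector_eq_ldot)
  qed
qed

text \<open>The score is the posterior mean of \<open>(1 / t) *\<^sub>R (y - x)\<close>, so this is
  Jensen's inequality. It is proved by expanding the nonnegative posterior variance around the score
  \<open>s\<close>.\<close>

lemma norm_score_dens_le: "(norm ((1 / dens x) *\<^sub>R grad x))\<^sup>2 * dens x \<le> sq x / t"
proof -
  define s where "s = (1 / dens x) *\<^sub>R grad x"
  have grad: "grad x = dens x *\<^sub>R s" using dens_pos[of x] by (simp add: s_def)
  have eq: "gauss_density t (x - y) * (norm ((1 / t) *\<^sub>R (y - x) - s))\<^sup>2
      = (gauss_density t (x - y) * (norm (x - y))\<^sup>2 / t) / t
        - 2 * (s \<bullet> ((gauss_density t (x - y) / t) *\<^sub>R (y - x))) + gauss_density t (x - y) * (norm s)\<^sup>2" for y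
  proof -
    have *: "(norm ((1 / t) *\<^sub>R (y - x) - s))\<^sup>2
        = (norm (x - y))\<^sup>2 / t\<^sup>2 - 2 / t * (s \<bullet> (y - x)) + (norm s)\<^sup>2"
      using norm_minus_commute[of x y] unfolding power2_norm_eq_inner norm_eq
      by (simp add: inner_diff inner_commute power2_eq_square algebra_simps
          add_divide_distrib diff_divide_distrib)
    show ?thesis unfolding * by (simp add: algebra_simps power2_eq_square)
  qed
  have "0 \<le> (\<integral>y. gauss_density t (x - y) * (norm ((1 / t) *\<^sub>R (y - x) - s))\<^sup>2 \<partial>\<mu>)"
    by (intro integral_nonneg_AE AE_I2 mult_nonneg_nonneg gauss_density_nonneg) auto
  also have "\<dots> = sq x / t - 2 * (s \<bullet> grad x) + dens x * (norm s)\<^sup>2"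
    unfolding eq sq_def grad_def dens_def
    by (intro has_bochner_integral_integral_eq has_bochner_integral_add has_bochner_integral_diff
        has_bochner_integral_divide_zero has_bochner_integral_mult_right has_bochner_integral_mult_left
        has_bochner_integral_inner_right has_bochner_integral_integrable integrable_gauss
        integrable_gauss_sq integrable_gauss_grad)
  also have "s \<bullet> grad x = dens x * (norm s)\<^sup>2"
    by (simp add: grad power2_norm_eq_inner)
  finally show ?thesis unfolding s_def[symmetric] by (simp add: mult.commute)
qed

text \<open>Integrates \<open>u \<le> ln A + exp u / A\<close> for \<open>u = \<parallel>x - y\<parallel>\<^sup>2 / (2t)\<close> against the Gaussian kernel, which
  cancels the factor \<open>exp u\<close>.\<close>

lemma sq_le:
  assumes A: "0 < A"
  shows "sq x \<le> 2 * (dens x * ln A + gauss_max TYPE('d) t / A)"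
proof -
  have "gauss_density t (x - y) * (norm (x - y))\<^sup>2 / t \<le> 2 * (gauss_density t (x - y) * ln A + gauss_max TYPE('d) t / A)" for y
  proof -
    define u where "u = (norm (x - y))\<^sup>2 / (2 * t)"
    have g: "gauss_density t (x - y) = gauss_max TYPE('d) t * exp (- u)"
      by (simp add: gauss_density_eq u_def)
    have "u - ln A \<le> exp (u - ln A)"
      using exp_ge_add_one_self[of "u - ln A"] by linarith
    also have "\<dots> = exp u / A" using A by (simp add: exp_diff)
    finally have "gauss_density t (x - y) * u \<le> gauss_density t (x - y) * (ln A + exp u / A)"
      by (intro mult_left_mono gauss_density_nonneg) simp
    also have "\<dots> = gauss_density t (x - y) * ln A + gauss_max TYPE('d) t / A"
      by (simp add: g algebra_simps exp_minus)
    finally show ?thesis using t by (simp add: u_def field_simps)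
  qed
  then have "sq x \<le> (\<integral>y. 2 * (gauss_density t (x - y) * ln A + gauss_max TYPE('d) t / A) \<partial>\<mu>)"
    unfolding sq_def by (intro integral_mono) auto
  also have "\<dots> = 2 * (dens x * ln A + gauss_max TYPE('d) t / A)"
    unfolding dens_def by (simp add: prob_space)
  finally show ?thesis .
qed

subsection \<open>Risk at a fixed time\<close>

text \<open>This is \<open>sq_le\<close> with \<open>A = n\<close>. Where \<open>dens x\<close> is
  at least \<open>gauss_max\<close> over \<open>n\<close>, the second summand is absorbed by
  \<open>dens x\<close>, which yields the bound \<open>2 * (1 + ln n) / t\<close> behind the
  threshold of \<open>kde_score\<close>.\<close>

lemma norm_score_le:
  assumes n: "0 < n"
  shows "(norm ((1 / dens x) *\<^sub>R grad x))\<^sup>2 * dens x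
    \<le> 2 / t * (dens x * ln (real n) + gauss_max TYPE('d) t / real n)"
proof -
  have "sq x / t \<le> 2 * (dens x * ln (real n) + gauss_max TYPE('d) t / real n) / t"
    using sq_le[of "real n" x] n t by (intro divide_right_mono) auto
  then show ?thesis using norm_score_dens_le[of x] by simp
qed

text \<open>One factor of the squared kernel is bounded by its maximum, the other integrates to
  \<open>dens x\<close>. A variance proportional to the density is what later cancels the division
  by the density.\<close>

lemma nn_integral_kde_le:
  assumes n: "0 < n"
  shows "(\<integral>\<^sup>+xs. ennreal ((kde n t xs x - dens x)\<^sup>2) \<partial>PiM {..<n} (\<lambda>_. \<mu>))
    \<le> ennreal (gauss_max TYPE('d) t * dens x / real n)"
proof -
  have "(\<integral>\<^sup>+xs. ennreal ((kde n t xs x - dens x)\<^sup>2) \<partial>PiM {..<n} (\<lambda>_. \<mu>))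
      \<le> ennreal (expectation (\<lambda>y. (gauss_density t (x - y))\<^sup>2) / real n)"
    unfolding kde_def dens_def
    by (intro nn_integral_square_mean_deviation_le[where K = "gauss_max TYPE('d) t"])
      (auto simp: gauss_density_le[OF t] gauss_density_nonneg n)
  also have "expectation (\<lambda>y. (gauss_density t (x - y))\<^sup>2)
      \<le> expectation (\<lambda>y. gauss_max TYPE('d) t * gauss_density t (x - y))"
    by (intro integral_mono' integrable_mult_right integrable_gauss)
      (auto simp: power2_eq_square gauss_density_nonneg gauss_max_nonneg gauss_density_le[OF t]
        intro!: mult_right_mono mult_nonneg_nonneg)
  also have "\<dots> = gauss_max TYPE('d) t * dens x"
    by (simp add: dens_def)
  finally show ?thesis by (simp add: divide_right_mono ennreal_leI)
qed

lemma nn_integral_kde_grad_le: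
  assumes n: "0 < n"
  shows "(\<integral>\<^sup>+xs. ennreal ((norm (kde_grad n t xs x - grad x))\<^sup>2) \<partial>PiM {..<n} (\<lambda>_. \<mu>))
    \<le> ennreal (gauss_max TYPE('d) t / t * dens x / real n)"
proof -
  have "(\<integral>\<^sup>+xs. ennreal ((norm (kde_grad n t xs x - grad x))\<^sup>2) \<partial>PiM {..<n} (\<lambda>_. \<mu>))
      \<le> ennreal (expectation (\<lambda>y. (norm ((gauss_density t (x - y) / t) *\<^sub>R (y - x)))\<^sup>2) / real n)"
    unfolding kde_grad_def grad_def
    by (intro nn_integral_square_mean_deviation_vec_le[OF _ norm_gauss_gradient_le_const n]) measurable
  also have "expectation (\<lambda>y. (norm ((gauss_density t (x - y) / t) *\<^sub>R (y - x)))\<^sup>2)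
      \<le> expectation (\<lambda>y. gauss_max TYPE('d) t / t * gauss_density t (x - y))"
    by (intro integral_mono' integrable_mult_right integrable_gauss norm_gauss_gradient_le[OF t])
      (use t in \<open>auto intro!: divide_nonneg_pos mult_nonneg_nonneg gauss_max_nonneg gauss_density_nonneg\<close>)
  also have "\<dots> = gauss_max TYPE('d) t / t * dens x"
    by (simp add: dens_def)
  finally show ?thesis by (simp add: divide_right_mono ennreal_leI)
qed

lemma kde_score_measurable_samples [measurable]:
  assumes [measurable]: "X \<in> N \<rightarrow>\<^sub>M borel" "XS \<in> N \<rightarrow>\<^sub>M PiM {..<n} (\<lambda>_. \<mu>)"
  shows "(\<lambda>w. kde_score n t (XS w) u (X w)) \<in> borel_measurable N"
  by (rule kde_score_measurable) (auto simp: measurable_cong_sets[OF refl sets_\<mu>, symmetric])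

lemma kde_score_pointwise_risk:
  assumes n: "0 < n"
  shows "(\<integral>\<^sup>+xs. ennreal ((norm (kde_score n t xs u x - (1 / dens x) *\<^sub>R grad x))\<^sup>2 * dens x)
      \<partial>PiM {..<n} (\<lambda>_. \<mu>)) \<le> ennreal (88 * (1 + ln (real n)) * gauss_max TYPE('d) t / (real n * t))"
proof -
  interpret P: prob_space "PiM {..<n} (\<lambda>_. \<mu>)"
    by (intro prob_space_PiM prob_space_axioms)
  define s where "s = (1 / dens x) *\<^sub>R grad x"
  define l where "l = 1 + ln (real n)"
  define c where "c = gauss_max TYPE('d) t"
  define p where "p = dens x"
  have l: "1 \<le> l" "ln (real n) \<le> l" using n by (auto simp: l_def)
  have c: "0 < c" using gauss_max_pos[OF t] by (simp add: c_def)
  have p: "0 < p" by (simp add: p_def dens_pos)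
  have s: "(norm s)\<^sup>2 * p \<le> 2 / t * (p * ln (real n) + c / real n)"
    using norm_score_le[OF n] by (simp add: s_def p_def c_def)
  have "(\<integral>\<^sup>+xs. ennreal ((norm (kde_score n t xs u x - s))\<^sup>2 * p) \<partial>PiM {..<n} (\<lambda>_. \<mu>))
      \<le> ennreal (88 * l * c / (real n * t))"
  proof (cases "p < c / real n")
    case True
    \<comment> \<open>Holds for every sample. The truncated estimate contributes 16 and the true
      score 4, after \<open>p\<close> is replaced by its upper bound \<open>c / n\<close>.\<close>
    have "(norm (kde_score n t xs u x - s))\<^sup>2 * p \<le> 20 * l * c / (real n * t)" for xs
    proof -
      have "(norm (kde_score n t xs u x - s))\<^sup>2 * p
          \<le> (2 * (4 * (2 * l / t)) + 2 * (norm s)\<^sup>2) * p"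
        using norm_diff_sq_le[of "kde_score n t xs u x" s]
          norm_kde_score_le[OF n t, of xs u x, folded l_def] p
        by (intro mult_right_mono) linarith+
      also have "\<dots> \<le> 2 * (4 * (2 * l / t)) * p + 2 * (2 / t * (p * ln (real n) + c / real n))"
        unfolding distrib_right mult.assoc[of 2 "(norm _)\<^sup>2"]
        by (intro add_left_mono mult_left_mono s) auto
      also have "\<dots> = (16 * l * p + 4 * (p * ln (real n) + c / real n)) / t"
        using t by (simp add: field_simps)
      also have "\<dots> \<le> (16 * l * (c / real n) + 4 * (c / real n * ln (real n) + c / real n)) / t"
        using True p t l n by (intro divide_right_mono add_mono mult_left_mono mult_right_mono) auto
      also have "\<dots> = 20 * l * c / (real n * t)"
        using t n by (simp add: l_def field_simps)
      finally show ?thesis .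
    qed
    then have "(norm (kde_score n t xs u x - s))\<^sup>2 * p \<le> 88 * l * c / (real n * t)" for xs
      using l c n t by (intro order.trans[OF _ divide_right_mono[OF mult_right_mono[OF mult_right_mono[of 20 88]]]]) auto
    then have "(\<integral>\<^sup>+xs. ennreal ((norm (kde_score n t xs u x - s))\<^sup>2 * p) \<partial>PiM {..<n} (\<lambda>_. \<mu>))
        \<le> (\<integral>\<^sup>+xs. ennreal (88 * l * c / (real n * t)) \<partial>PiM {..<n} (\<lambda>_. \<mu>))"
      by (intro nn_integral_mono ennreal_leI) auto
    then show ?thesis
      by (simp add: P.emeasure_space_1)
  next
    case False
    \<comment> \<open>With this choice \<open>4 * B\<close> is exactly the threshold in
      \<open>kde_score\<close>.\<close>
    define B where "B = 2 * l / t"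
    have B0: "0 \<le> B" using l t by (simp add: B_def)
    have sB: "(norm s)\<^sup>2 \<le> B"
    proof -
      have "(norm s)\<^sup>2 * p \<le> 2 / t * (p * ln (real n) + p)"
        using False t by (intro order.trans[OF s] mult_left_mono) auto
      also have "\<dots> = B * p" by (simp add: B_def l_def algebra_simps add_divide_distrib)
      finally show ?thesis using p by simp
    qed
    have meas [measurable]: "(\<lambda>xs. kde n t xs x) \<in> borel_measurable (PiM {..<n} (\<lambda>_. \<mu>))"
        "(\<lambda>xs. kde_grad n t xs x) \<in> borel_measurable (PiM {..<n} (\<lambda>_. \<mu>))"
      unfolding kde_def kde_grad_def by measurable
    have "(norm (kde_score n t xs u x - s))\<^sup>2 * p
        \<le> 40 * B * ((kde n t xs x - p)\<^sup>2 / p) + 8 * ((norm (kde_grad n t xs x - grad x))\<^sup>2 / p)" for xs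
      unfolding s_def p_def[symmetric]
    proof (rule ratio_deviation_bound)
      show "(norm ((1 / p) *\<^sub>R grad x))\<^sup>2 \<le> B" using sB by (simp add: s_def p_def)
      show "kde_score n t xs u x = (let w = (1 / kde n t xs x) *\<^sub>R kde_grad n t xs x
          in if (norm w)\<^sup>2 \<le> 4 * B then w else 0)"
        by (simp add: kde_score_def B_def l_def)
    qed (rule p)
    then have "(\<integral>\<^sup>+xs. ennreal ((norm (kde_score n t xs u x - s))\<^sup>2 * p) \<partial>PiM {..<n} (\<lambda>_. \<mu>))
        \<le> (\<integral>\<^sup>+xs. ennreal (40 * B / p) * ennreal ((kde n t xs x - p)\<^sup>2)
            + ennreal (8 / p) * ennreal ((norm (kde_grad n t xs x - grad x))\<^sup>2) \<partial>PiM {..<n} (\<lambda>_. \<mu>))"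
      using p B0 by (intro nn_integral_mono)
        (simp add: ennreal_mult[symmetric] ennreal_plus[symmetric] ennreal_leI del: ennreal_plus)
    also have "\<dots> = ennreal (40 * B / p) * (\<integral>\<^sup>+xs. ennreal ((kde n t xs x - p)\<^sup>2) \<partial>PiM {..<n} (\<lambda>_. \<mu>))
        + ennreal (8 / p) * (\<integral>\<^sup>+xs. ennreal ((norm (kde_grad n t xs x - grad x))\<^sup>2) \<partial>PiM {..<n} (\<lambda>_. \<mu>))"
      by (simp add: nn_integral_add nn_integral_cmult)
    \<comment> \<open>Both mean square deviations carry a factor \<open>p\<close>, which cancels the
      denominators.\<close>
    also have "\<dots> \<le> ennreal (40 * B / p) * ennreal (c * p / real n)
        + ennreal (8 / p) * ennreal (c / t * p / real n)"
      unfolding c_def p_def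
      by (intro add_mono mult_left_mono nn_integral_kde_le nn_integral_kde_grad_le n) auto
    also have "\<dots> = ennreal (40 * B * c / real n + 8 * c / (t * real n))"
      using p c t n B0 by (simp add: ennreal_mult[symmetric] ennreal_plus[symmetric] del: ennreal_plus)
    also have "\<dots> \<le> ennreal (88 * l * c / (real n * t))"
    proof (rule ennreal_leI)
      have "40 * B * c / real n + 8 * c / (t * real n) = (80 * l + 8) * (c / (real n * t))"
        using t n by (simp add: B_def field_simps)
      also have "\<dots> \<le> (88 * l) * (c / (real n * t))"
        using l c n t by (intro mult_right_mono) auto
      finally show "40 * B * c / real n + 8 * c / (t * real n) \<le> 88 * l * c / (real n * t)" by simp
    qed
    finally show ?thesis .
  qed
  then show ?thesis by (simp only: s_def l_def c_def p_def)
qed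

text \<open>Up to a constant, the kernel of variance \<open>t\<close> is the kernel of variance
  \<open>2 * t\<close> times \<open>exp (- u / 4)\<close>. Half of this spare exponent absorbs the
  factor \<open>16 * l + 2 * u\<close>. The other half pays for the decay in \<open>R\<close>,
  because the square of \<open>R\<close> is at most twice the sum of the squared norms of
  \<open>y\<close> and \<open>z\<close>; this is where the bound on \<open>a\<close> enters.\<close>

lemma gauss_density_tail:
  assumes a: "0 \<le> a" "a \<le> 1 / (16 * t)" and l: "1 \<le> l" and R: "0 \<le> R" "R < norm x"
  shows "(16 * l * gauss_density t (x - y) + 2 * (gauss_density t (x - y) * (norm (x - y))\<^sup>2 / t)) / t
    \<le> 16 * l / t * 2 powr (real CARD('d) / 2) * exp (- a * R\<^sup>2) * exp (2 * a * (norm y)\<^sup>2)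
      * gauss_density (2 * t) (x - y :: real ^ 'd)"
proof -
  define z where "z = x - y"
  define u where "u = (norm z)\<^sup>2 / t"
  have g: "gauss_density t z = 2 powr (real CARD('d) / 2) * gauss_density (2 * t) z * exp (- u / 4)"
  proof -
    have "(2 * pi * t) powr (- (real CARD('d) / 2))
        = 2 powr (real CARD('d) / 2) * (2 * pi * (2 * t)) powr (- (real CARD('d) / 2))"
      using t by (simp add: powr_mult powr_minus field_simps flip: powr_add)
    then show ?thesis
      unfolding gauss_density_def u_def
      by (simp add: mult_exp_exp mult.assoc)
  qed
  have "R\<^sup>2 \<le> 2 * (norm y)\<^sup>2 + 2 * (norm z)\<^sup>2"
  proof -
    have "R\<^sup>2 \<le> (norm x)\<^sup>2" using R by (intro power_mono) auto
    also have "\<dots> \<le> 2 * (norm z)\<^sup>2 + 2 * (norm (- y))\<^sup>2"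
      using norm_diff_sq_le[of z "- y"] by (simp add: z_def)
    finally show ?thesis by simp
  qed
  then have "a * R\<^sup>2 \<le> a * (2 * (norm y)\<^sup>2 + 2 * (norm z)\<^sup>2)"
    using a by (intro mult_left_mono)
  moreover have "2 * a * (norm z)\<^sup>2 \<le> u / 8"
    using mult_right_mono[OF a(2), of "2 * (norm z)\<^sup>2"] t by (simp add: u_def field_simps)
  ultimately have e: "u / 8 \<le> - a * R\<^sup>2 + 2 * a * (norm y)\<^sup>2 + u / 4"
    by (simp add: algebra_simps)
  have "16 * l + 2 * u \<le> 16 * l * exp (u / 8)"
  proof -
    have "16 * l + 2 * u \<le> 16 * l * (1 + u / 8)"
      using l t mult_right_mono[of 1 l u] by (simp add: algebra_simps) (simp add: u_def)
    also have "\<dots> \<le> 16 * l * exp (u / 8)"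
      using l exp_ge_add_one_self[of "u / 8"] by (intro mult_left_mono) auto
    finally show ?thesis .
  qed
  also have "\<dots> \<le> 16 * l * exp (- a * R\<^sup>2 + 2 * a * (norm y)\<^sup>2 + u / 4)"
    using l e by (intro mult_left_mono) auto
  finally have "gauss_density t z * (16 * l + 2 * u) / t
      \<le> gauss_density t z * (16 * l * exp (- a * R\<^sup>2 + 2 * a * (norm y)\<^sup>2 + u / 4)) / t"
    using t by (intro divide_right_mono mult_left_mono gauss_density_nonneg) auto
  also have "gauss_density t z * (16 * l * exp (- a * R\<^sup>2 + 2 * a * (norm y)\<^sup>2 + u / 4)) / t
      = 16 * l / t * 2 powr (real CARD('d) / 2) * exp (- a * R\<^sup>2) * exp (2 * a * (norm y)\<^sup>2)
        * gauss_density (2 * t) z"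
  proof -
    have "exp (- u / 4) * exp (- a * R\<^sup>2 + 2 * a * (norm y)\<^sup>2 + u / 4)
        = exp (- a * R\<^sup>2) * exp (2 * a * (norm y)\<^sup>2)"
      by (simp flip: exp_add)
    then have "2 powr (real CARD('d) / 2) * gauss_density (2 * t) z * 16 * l / t
        * (exp (- u / 4) * exp (- a * R\<^sup>2 + 2 * a * (norm y)\<^sup>2 + u / 4))
      = 2 powr (real CARD('d) / 2) * gauss_density (2 * t) z * 16 * l / t
        * (exp (- a * R\<^sup>2) * exp (2 * a * (norm y)\<^sup>2))"
      by (rule arg_cong)
    then show ?thesis unfolding g by (simp only: mult_ac times_divide_eq_right times_divide_eq_left)
  qed
  finally show ?thesis
    unfolding z_def[symmetric] by (simp add: u_def algebra_simps)
qed

text \<open>After exchanging the integrals, the kernel of variance \<open>2 * t\<close> integrates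
  to 1 over \<open>x\<close> for every \<open>y\<close>, and only the Gaussian moment of \<mu>
  remains.\<close>

lemma score_tail_le:
  assumes a: "0 \<le> a" "a \<le> 1 / (16 * t)" and l: "1 \<le> l" and R: "0 \<le> R" and M: "0 \<le> M"
    and exp_moment: "(\<integral>\<^sup>+y. ennreal (exp (2 * a * (norm y)\<^sup>2)) \<partial>\<mu>) \<le> ennreal M"
  shows "(\<integral>\<^sup>+x. ennreal ((16 * l * dens x + 2 * sq x) / t) * indicator (- cball 0 R) x \<partial>lborel)
    \<le> ennreal (16 * l / t * 2 powr (real CARD('d) / 2) * exp (- a * R\<^sup>2) * M)"
proof -
  interpret PS: pair_sigma_finite lborel \<mu> ..
  define C where "C = 16 * l / t * 2 powr (real CARD('d) / 2) * exp (- a * R\<^sup>2)"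
  have C: "0 \<le> C" using l t by (simp add: C_def)
  have "ennreal ((16 * l * dens x + 2 * sq x) / t) * indicator (- cball 0 R) x
      \<le> (\<integral>\<^sup>+y. ennreal (C * exp (2 * a * (norm y)\<^sup>2) * gauss_density (2 * t) (x - y)) \<partial>\<mu>)" for x
  proof (cases "R < norm x")
    case True
    have "ennreal ((16 * l * dens x + 2 * sq x) / t)
        = (\<integral>\<^sup>+y. ennreal ((16 * l * gauss_density t (x - y)
            + 2 * (gauss_density t (x - y) * (norm (x - y))\<^sup>2 / t)) / t) \<partial>\<mu>)"
      using l t unfolding dens_def sq_def
      by (subst nn_integral_eq_integral)
        (auto simp: gauss_density_nonneg intro!: AE_I2 divide_nonneg_pos add_nonneg_nonneg
          simp del: times_divide_eq_right times_divide_eq_left)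
    also have "\<dots> \<le> (\<integral>\<^sup>+y. ennreal (C * exp (2 * a * (norm y)\<^sup>2) * gauss_density (2 * t) (x - y)) \<partial>\<mu>)"
      unfolding C_def
      by (intro nn_integral_mono ennreal_leI gauss_density_tail a l R True)
    finally show ?thesis using True by simp
  next
    case False
    then show ?thesis by simp
  qed
  then have "(\<integral>\<^sup>+x. ennreal ((16 * l * dens x + 2 * sq x) / t) * indicator (- cball 0 R) x \<partial>lborel)
      \<le> (\<integral>\<^sup>+x. \<integral>\<^sup>+y. ennreal (C * exp (2 * a * (norm y)\<^sup>2) * gauss_density (2 * t) (x - y)) \<partial>\<mu> \<partial>lborel)"
    by (intro nn_integral_mono)
  also have "\<dots> = (\<integral>\<^sup>+y. \<integral>\<^sup>+x. ennreal (C * exp (2 * a * (norm y)\<^sup>2) * gauss_density (2 * t) (x - y)) \<partial>lborel \<partial>\<mu>)"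
    by (rule PS.Fubini'[symmetric]) measurable
  also have "\<dots> = (\<integral>\<^sup>+y. ennreal C * ennreal (exp (2 * a * (norm y)\<^sup>2)) \<partial>\<mu>)"
  proof (intro nn_integral_cong)
    fix y
    have "(\<integral>\<^sup>+x. ennreal (gauss_density (2 * t) (x - y)) \<partial>lborel) = 1"
      using nn_integral_lborel_shift[of "\<lambda>x. ennreal (gauss_density (2 * t) x)" y] t
      by (simp add: nn_integral_gauss_density)
    then show "(\<integral>\<^sup>+x. ennreal (C * exp (2 * a * (norm y)\<^sup>2) * gauss_density (2 * t) (x - y)) \<partial>lborel)
        = ennreal C * ennreal (exp (2 * a * (norm y)\<^sup>2))"
      using C by (simp add: ennreal_mult gauss_density_nonneg nn_integral_cmult)
  qed
  also have "\<dots> = ennreal C * (\<integral>\<^sup>+y. ennreal (exp (2 * a * (norm y)\<^sup>2)) \<partial>\<mu>)"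
    by (rule nn_integral_cmult) measurable
  also have "\<dots> \<le> ennreal C * ennreal M"
    using exp_moment by (rule mult_left_mono) simp
  also have "\<dots> = ennreal (C * M)" using C M by (simp add: ennreal_mult)
  finally show ?thesis by (simp add: C_def)
qed

lemma kde_score_risk:
  assumes n: "2 \<le> n" and a\<^sub>0: "0 < a\<^sub>0" and M: "0 \<le> M"
    and exp_moment: "(\<integral>\<^sup>+y. ennreal (exp (a\<^sub>0 * (norm y)\<^sup>2)) \<partial>\<mu>) \<le> ennreal M"
  shows "(\<integral>\<^sup>+xs. \<integral>\<^sup>+x. ennreal ((norm (kde_score n t xs u x - (1 / dens x) *\<^sub>R grad x))\<^sup>2 * dens x)
      \<partial>lborel \<partial>PiM {..<n} (\<lambda>_. \<mu>))
    \<le> ennreal (88 * (1 + ln (real n)) * gauss_max TYPE('d) t / (real n * t)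
          * (unit_ball_vol (real CARD('d)) * sqrt (ln (real n) * (16 * t + 2 / a\<^sub>0)) ^ CARD('d))
        + 16 * (1 + ln (real n)) / t * 2 powr (real CARD('d) / 2) * (1 / real n) * M)"
proof -
  interpret P: prob_space "PiM {..<n} (\<lambda>_. \<mu>)"
    by (intro prob_space_PiM prob_space_axioms)
  interpret PS: pair_sigma_finite "PiM {..<n} (\<lambda>_. \<mu>)" "lborel :: (real ^ 'd) measure" ..
  define h where "h xs x = ennreal ((norm (kde_score n t xs u x - (1 / dens x) *\<^sub>R grad x))\<^sup>2 * dens x)" for xs x
  define l where "l = 1 + ln (real n)"
  \<comment> \<open>Chosen to satisfy both \<open>a \<le> 1 / (16 * t)\<close>, for the tail bound,
    and \<open>2 * a \<le> a\<^sub>0\<close>, for the moment.\<close>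
  define a where "a = 1 / (16 * t + 2 / a\<^sub>0)"
  \<comment> \<open>The squared radius is \<open>ln n / a\<close>, which makes the decay factor of
    the tail equal to \<open>1 / n\<close>.\<close>
  define R where "R = sqrt (ln (real n) * (16 * t + 2 / a\<^sub>0))"
  define K where "K = 88 * l * gauss_max TYPE('d) t / (real n * t)"
  have l: "1 \<le> l" using n by (simp add: l_def)
  have K: "0 \<le> K" using l t gauss_max_pos[OF t, where 'd = 'd] by (simp add: K_def)
  have R: "0 \<le> R" using n t a\<^sub>0 by (simp add: R_def)
  have a: "0 \<le> a" "a \<le> 1 / (16 * t)"
    using t a\<^sub>0 by (auto simp: a_def frac_le)
  have "a \<le> 1 / (2 / a\<^sub>0)"
    unfolding a_def using t a\<^sub>0 by (intro frac_le) auto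
  then have "2 * a \<le> a\<^sub>0" by simp
  then have "(\<integral>\<^sup>+y. ennreal (exp (2 * a * (norm y)\<^sup>2)) \<partial>\<mu>) \<le> (\<integral>\<^sup>+y. ennreal (exp (a\<^sub>0 * (norm y)\<^sup>2)) \<partial>\<mu>)"
    by (intro nn_integral_mono ennreal_leI) (simp add: mult_right_mono)
  with exp_moment have moment: "(\<integral>\<^sup>+y. ennreal (exp (2 * a * (norm y)\<^sup>2)) \<partial>\<mu>) \<le> ennreal M" by simp
  have exp_aR: "exp (- a * R\<^sup>2) = 1 / real n"
  proof -
    have "16 * t + 2 / a\<^sub>0 \<noteq> 0" using t a\<^sub>0 by (smt (verit) divide_pos_pos)
    moreover have "0 \<le> ln (real n) * (16 * t + 2 / a\<^sub>0)" using n t a\<^sub>0 by simp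
    ultimately have "a * R\<^sup>2 = ln (real n)" by (simp add: a_def R_def)
    then show ?thesis using n by (simp add: exp_minus inverse_eq_divide)
  qed
  have meas: "case_prod h \<in> borel_measurable (PiM {..<n} (\<lambda>_. \<mu>) \<Otimes>\<^sub>M lborel)"
    unfolding h_def by measurable
  have [measurable]: "(\<lambda>xs. h xs x) \<in> borel_measurable (PiM {..<n} (\<lambda>_. \<mu>))" for x
    unfolding h_def by measurable
  have inside: "(\<integral>\<^sup>+xs. h xs x \<partial>PiM {..<n} (\<lambda>_. \<mu>)) \<le> ennreal K" for x
    unfolding h_def K_def l_def using n by (intro kde_score_pointwise_risk) auto
  \<comment> \<open>This bound uses no averaging over the samples: truncation and
    \<open>norm_score_dens_le\<close> suffice for every sample.\<close>
  have outside: "(\<integral>\<^sup>+xs. h xs x \<partial>PiM {..<n} (\<lambda>_. \<mu>)) \<le> ennreal ((16 * l * dens x + 2 * sq x) / t)" for x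
  proof -
    have "(norm (kde_score n t xs u x - (1 / dens x) *\<^sub>R grad x))\<^sup>2 * dens x
        \<le> (16 * l * dens x + 2 * sq x) / t" for xs
    proof -
      have "(norm (kde_score n t xs u x - (1 / dens x) *\<^sub>R grad x))\<^sup>2 * dens x
          \<le> (2 * (4 * (2 * l / t)) + 2 * (norm ((1 / dens x) *\<^sub>R grad x))\<^sup>2) * dens x"
        using norm_diff_sq_le[of "kde_score n t xs u x" "(1 / dens x) *\<^sub>R grad x"]
          norm_kde_score_le[of n t xs u x, folded l_def] n t dens_pos[of x]
        by (intro mult_right_mono) auto
      also have "\<dots> \<le> 2 * (4 * (2 * l / t)) * dens x + 2 * (sq x / t)"
        unfolding distrib_right mult.assoc[of 2 "(norm _)\<^sup>2"]
        by (intro add_left_mono mult_left_mono norm_score_dens_le) auto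
      also have "\<dots> = (16 * l * dens x + 2 * sq x) / t"
        using t by (simp add: field_simps)
      finally show ?thesis .
    qed
    then have "(\<integral>\<^sup>+xs. h xs x \<partial>PiM {..<n} (\<lambda>_. \<mu>))
        \<le> (\<integral>\<^sup>+xs. ennreal ((16 * l * dens x + 2 * sq x) / t) \<partial>PiM {..<n} (\<lambda>_. \<mu>))"
      unfolding h_def by (intro nn_integral_mono ennreal_leI)
    then show ?thesis by (simp add: P.emeasure_space_1)
  qed
  have "(\<integral>\<^sup>+xs. \<integral>\<^sup>+x. h xs x \<partial>lborel \<partial>PiM {..<n} (\<lambda>_. \<mu>))
      = (\<integral>\<^sup>+x. \<integral>\<^sup>+xs. h xs x \<partial>PiM {..<n} (\<lambda>_. \<mu>) \<partial>lborel)"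
    by (rule PS.Fubini'[symmetric, OF meas])
  also have "\<dots> \<le> (\<integral>\<^sup>+x. ennreal K * indicator (cball 0 R) x
      + ennreal ((16 * l * dens x + 2 * sq x) / t) * indicator (- cball 0 R) x \<partial>lborel)"
    using inside outside by (intro nn_integral_mono) (auto split: split_indicator)
  also have "\<dots> = ennreal K * emeasure lborel (cball (0 :: real ^ 'd) R)
      + (\<integral>\<^sup>+x. ennreal ((16 * l * dens x + 2 * sq x) / t) * indicator (- cball 0 R) x \<partial>lborel)"
  proof (subst nn_integral_add)
    have [measurable]: "cball (0 :: real ^ 'd) R \<in> sets borel" by simp
    show "(\<lambda>x :: real ^ 'd. ennreal K * indicator (cball 0 R) x) \<in> borel_measurable lborel"
      by measurable
    show "(\<lambda>x. ennreal ((16 * l * dens x + 2 * sq x) / t) * indicator (- cball 0 R) x) \<in> borel_measurable lborel"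
      by measurable
  qed (simp add: nn_integral_cmult_indicator)
  also have "\<dots> \<le> ennreal K * ennreal (unit_ball_vol (real CARD('d)) * R ^ CARD('d))
      + ennreal (16 * l / t * 2 powr (real CARD('d) / 2) * exp (- a * R\<^sup>2) * M)"
    using emeasure_cball[OF R, of "0 :: real ^ 'd"]
    by (intro add_mono score_tail_le a l R M moment) simp
  also have "\<dots> = ennreal (K * (unit_ball_vol (real CARD('d)) * R ^ CARD('d))
      + 16 * l / t * 2 powr (real CARD('d) / 2) * exp (- a * R\<^sup>2) * M)"
    using K R l t M by (simp add: ennreal_mult[symmetric] ennreal_plus[symmetric] del: ennreal_plus)
  finally show ?thesis
    unfolding h_def exp_aR by (simp add: K_def R_def l_def)
qed

end

section \<open>Integrated risk under a sub-Gaussian law\<close>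

lemma prob_space_law: "prob_density p \<Longrightarrow> prob_space (law p)"
  unfolding prob_density_def law_def
  by (intro prob_spaceI) (simp add: emeasure_density)

text \<open>Only the coordinate directions of the supremum are used. The squared norm is at most the
  dimension times the largest squared coordinate, so its exponential is dominated by the sum of the
  coordinate exponentials, each with expectation at most 2.\<close>

lemma sub_gaussian_exp_moment:
  fixes p :: "real ^ 'd::finite \<Rightarrow> real"
  assumes p: "prob_density p" and sg: "sub_gaussian \<sigma> p"
  obtains a M where "0 < a" "0 \<le> M" "(\<integral>\<^sup>+y. ennreal (exp (a * (norm y)\<^sup>2)) \<partial>law p) \<le> ennreal M"
proof -
  interpret prob_space "law p" by (rule prob_space_law[OF p])
  have [measurable_cong]: "sets (law p) = sets borel" by (simp add: law_def)
  have \<sigma>: "0 \<le> \<sigma>" "psi2_norm_vec (law p) (\<lambda>x. x) = ennreal \<sigma>"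
    using sg by (auto simp: sub_gaussian_def)
  \<comment> \<open>Being strictly above \<sigma>, \<open>C\<close> exceeds some admissible constant
    in the infimum, whether or not that infimum is attained.\<close>
  define C where "C = \<sigma> + 1"
  have C: "0 < C" using \<sigma> by (simp add: C_def)
  define a where "a = 1 / (real CARD('d) * C\<^sup>2)"
  have coord: "(\<integral>\<^sup>+y. ennreal (exp ((y \<bullet> b)\<^sup>2 / C\<^sup>2)) \<partial>law p) \<le> 2" if "b \<in> Basis" for b
  proof -
    have "psi2_norm (law p) (\<lambda>x. x \<bullet> b) \<le> psi2_norm_vec (law p) (\<lambda>x. x)"
      unfolding psi2_norm_vec_def using that by (intro SUP_upper) auto
    also have "\<dots> < ennreal C" using \<sigma> by (simp add: C_def ennreal_lessI)
    finally obtain C' where C': "0 < C'" "ennreal C' < ennreal C"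
        "(\<integral>\<^sup>+w. ennreal (exp ((w \<bullet> b)\<^sup>2 / C'\<^sup>2) - 1) \<partial>law p) \<le> 1"
      unfolding psi2_norm_def Inf_less_iff by auto
    have "C'\<^sup>2 \<le> C\<^sup>2" using C' by (intro power_mono) (auto simp: ennreal_less_iff)
    then have "ennreal (exp ((y \<bullet> b)\<^sup>2 / C\<^sup>2)) \<le> ennreal (exp ((y \<bullet> b)\<^sup>2 / C'\<^sup>2) - 1) + 1" for y
      using C' C by (simp add: frac_le ennreal_leI flip: ennreal_1 ennreal_plus)
    then have "(\<integral>\<^sup>+y. ennreal (exp ((y \<bullet> b)\<^sup>2 / C\<^sup>2)) \<partial>law p)
        \<le> (\<integral>\<^sup>+y. ennreal (exp ((y \<bullet> b)\<^sup>2 / C'\<^sup>2) - 1) + 1 \<partial>law p)"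
      by (intro nn_integral_mono)
    also have "\<dots> = (\<integral>\<^sup>+y. ennreal (exp ((y \<bullet> b)\<^sup>2 / C'\<^sup>2) - 1) \<partial>law p) + 1"
      by (simp add: nn_integral_add emeasure_space_1)
    also have "\<dots> \<le> 1 + 1" using C'(3) by (rule add_right_mono)
    finally show ?thesis by simp
  qed
  have le: "exp (a * (norm y)\<^sup>2) \<le> (\<Sum>b\<in>Basis. exp ((y \<bullet> b)\<^sup>2 / C\<^sup>2))" for y :: "real ^ 'd"
  proof -
    define m where "m = Max ((\<lambda>b. (y \<bullet> b)\<^sup>2) ` Basis)"
    have "m \<in> (\<lambda>b. (y \<bullet> b)\<^sup>2) ` Basis" unfolding m_def by (intro Max_in) auto
    then obtain b where b: "b \<in> Basis" "m = (y \<bullet> b)\<^sup>2" by auto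
    have "(norm y)\<^sup>2 = (\<Sum>b\<in>Basis. (y \<bullet> b)\<^sup>2)"
      by (rule norm_sq_eq_sum_Basis)
    also have "\<dots> \<le> (\<Sum>b\<in>(Basis :: (real ^ 'd) set). m)"
      unfolding m_def by (intro sum_mono Max_ge) auto
    finally have "a * (norm y)\<^sup>2 \<le> a * (real CARD('d) * (y \<bullet> b)\<^sup>2)"
      using b C by (intro mult_left_mono) (auto simp: a_def)
    then have "exp (a * (norm y)\<^sup>2) \<le> exp ((y \<bullet> b)\<^sup>2 / C\<^sup>2)" by (simp add: a_def)
    also have "\<dots> \<le> (\<Sum>b\<in>Basis. exp ((y \<bullet> b)\<^sup>2 / C\<^sup>2))"
      using b by (intro member_le_sum) auto
    finally show ?thesis .
  qed
  have "(\<integral>\<^sup>+y. ennreal (exp (a * (norm y)\<^sup>2)) \<partial>law p)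
      \<le> (\<integral>\<^sup>+y. (\<Sum>b\<in>Basis. ennreal (exp ((y \<bullet> b)\<^sup>2 / C\<^sup>2))) \<partial>law p)"
    using le by (intro nn_integral_mono) (simp add: ennreal_leI)
  also have "\<dots> = (\<Sum>b\<in>Basis. \<integral>\<^sup>+y. ennreal (exp ((y \<bullet> b)\<^sup>2 / C\<^sup>2)) \<partial>law p)"
    by (rule nn_integral_sum) measurable
  also have "\<dots> \<le> (\<Sum>b\<in>(Basis :: (real ^ 'd) set). 2)"
    by (intro sum_mono coord)
  also have "\<dots> = ennreal (2 * real CARD('d))"
    by (simp add: ennreal_mult mult.commute ennreal_of_nat_eq_real_of_nat)
  finally have "(\<integral>\<^sup>+y. ennreal (exp (a * (norm y)\<^sup>2)) \<partial>law p) \<le> ennreal (2 * real CARD('d))" .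
  moreover have "0 < a" using C by (simp add: a_def)
  ultimately show ?thesis by (intro that[of a "2 * real CARD('d)"]) auto
qed

text \<open>The estimator is deterministic, so the law of the seed is taken to be the point mass at
  0.\<close>

lemma score_estimator_kde_score: "score_estimator (return borel 0) (kde_score :: 'd::finite score_rule)"
  unfolding score_estimator_def
proof (intro conjI allI impI)
  fix n :: nat
  let ?N = "restrict_space borel {0<..} \<Otimes>\<^sub>M PiM {..<n} (\<lambda>_. borel) \<Otimes>\<^sub>M borel \<Otimes>\<^sub>M borel
    :: (real \<times> (nat \<Rightarrow> real ^ 'd) \<times> real \<times> (real ^ 'd)) measure"
  have "(\<lambda>w. fst (w :: real \<times> (nat \<Rightarrow> real ^ 'd) \<times> real \<times> (real ^ 'd))) \<in> borel_measurable ?N"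
    by (intro measurable_compose[OF measurable_fst measurable_restrict_space1]) simp
  then have "(\<lambda>w. kde_score n (fst w) (fst (snd w)) (fst (snd (snd w))) (snd (snd (snd w))))
      \<in> borel_measurable ?N"
    by (rule kde_score_measurable) measurable
  then show "(\<lambda>(t, xs, u, x). kde_score n t xs u x) \<in> borel_measurable ?N"
    by (simp add: case_prod_unfold)
qed (auto intro: prob_space_return)

section \<open>From the risk at a fixed time to the integrated risk\<close>

lemma score_risk_kde_score_le:
  fixes p :: "real ^ 'd::finite \<Rightarrow> real"
  assumes p: "prob_density p" and t: "0 < t" and n: "2 \<le> n" and a\<^sub>0: "0 < a\<^sub>0" and M: "0 \<le> M"
    and moment: "(\<integral>\<^sup>+y. ennreal (exp (a\<^sub>0 * (norm y)\<^sup>2)) \<partial>law p) \<le> ennreal M"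
  shows "score_risk (return borel 0) kde_score p n t
    \<le> ennreal (88 * (1 + ln (real n)) * gauss_max TYPE('d) t / (real n * t)
          * (unit_ball_vol (real CARD('d)) * sqrt (ln (real n) * (16 * t + 2 / a\<^sub>0)) ^ CARD('d))
        + 16 * (1 + ln (real n)) / t * 2 powr (real CARD('d) / 2) * (1 / real n) * M)"
proof -
  interpret prob_space "law p" by (rule prob_space_law[OF p])
  interpret gauss_smoothing "law p" t
    by unfold_locales (auto simp: law_def t)
  interpret Q: prob_space "return borel (0 :: real)" by (rule prob_space_return) simp
  have smoothed: "smoothed p t x = dens x" for x
    using p unfolding smoothed_def dens_def prob_density_def
    unfolding law_def by (subst integral_density) auto
  have score: "score p t x = (1 / dens x) *\<^sub>R grad x" for x
    unfolding score_def smoothed by (rule gradient_ln_dens)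
  define F where "F xs = (\<integral>\<^sup>+x. ennreal ((norm (kde_score n t xs 0 x - (1 / dens x) *\<^sub>R grad x))\<^sup>2 * dens x)
      \<partial>lborel)" for xs
  have [measurable]: "F \<in> borel_measurable (PiM {..<n} (\<lambda>_. law p))"
    unfolding F_def[abs_def] by measurable
  have "(\<integral>\<^sup>+x. ennreal ((norm (kde_score n t xs u x - (1 / dens x) *\<^sub>R grad x))\<^sup>2 * dens x) \<partial>lborel)
      = F xs" for xs u
    unfolding F_def kde_score_def ..
  then have "score_risk (return borel 0) kde_score p n t
      = (\<integral>\<^sup>+z. F (fst z) \<partial>(PiM {..<n} (\<lambda>_. law p) \<Otimes>\<^sub>M return borel (0 :: real)))"
    unfolding score_risk_def score smoothed case_prod_unfold by simp
  also have "\<dots> = (\<integral>\<^sup>+xs. \<integral>\<^sup>+u. F xs \<partial>return borel (0 :: real) \<partial>PiM {..<n} (\<lambda>_. law p))"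
    by (subst Q.nn_integral_fst[symmetric]) auto
  also have "\<dots> = (\<integral>\<^sup>+xs. F xs \<partial>PiM {..<n} (\<lambda>_. law p))"
    by (simp add: Q.emeasure_space_1 del: space_return)
  finally show ?thesis
    using kde_score_risk[OF n a\<^sub>0 M moment] by (simp add: F_def)
qed

text \<open>The volume of the ball times the maximum of the kernel is bounded uniformly over all
  \<open>t \<ge> t\<^sub>0\<close>: for large \<open>t\<close> the growth of the radius is offset by
  the decay of the kernel. Only the factor \<open>1 / t\<close> is kept for the time
  integral.\<close>

lemma score_risk_kde_score_polylog:
  fixes p :: "real ^ 'd::finite \<Rightarrow> real"
  assumes p: "prob_density p" and n: "2 \<le> n" and a\<^sub>0: "0 < a\<^sub>0" and M: "0 \<le> M"
    and moment: "(\<integral>\<^sup>+y. ennreal (exp (a\<^sub>0 * (norm y)\<^sup>2)) \<partial>law p) \<le> ennreal M"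
    and t\<^sub>0: "0 < t\<^sub>0" "t\<^sub>0 \<le> 1" "t\<^sub>0 \<le> t"
  shows "score_risk (return borel 0) kde_score p n t
    \<le> ennreal (3 * (88 * unit_ball_vol (real CARD('d)) * (16 + 2 / a\<^sub>0) powr (real CARD('d) / 2)
        + 16 * 4 powr (real CARD('d) / 2) * M)
      * ln (real n) powr (1 + real CARD('d) / 2) * (1 / real n) * t\<^sub>0 powr (- (real CARD('d) / 2)) / t)"
proof -
  \<comment> \<open>Half the dimension, the exponent of all powers below.\<close>
  define d where "d = real CARD('d) / 2"
  define L where "L = ln (real n)"
  define V where "V = unit_ball_vol (real CARD('d))"
  define E where "E = 16 + 2 / a\<^sub>0"
  have d: "0 \<le> d" by (simp add: d_def)
  have t: "0 < t" using t\<^sub>0 by linarith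
  have V: "0 \<le> V" by (simp add: V_def)
  have E: "0 < E" using a\<^sub>0 by (simp add: E_def add_pos_pos)
  \<comment> \<open>Since \<open>ln 2 < 1\<close>, constants are absorbed into powers of
    \<open>L\<close> through this bound: it gives \<open>1 + L \<le> 3 * L\<close> and
    \<open>1 \<le> 2 * L\<close>.\<close>
  have L2: "1 / 2 \<le> L"
  proof -
    have "1 / 2 \<le> ln (2 :: real)" by (rule ln_ge_iff[THEN iffD2]) (simp_all add: exp_half_le2)
    also have "\<dots> \<le> L" using n by (simp add: L_def)
    finally show ?thesis .
  qed
  have c: "gauss_max TYPE('d) t * sqrt (L * (16 * t + 2 / a\<^sub>0)) ^ CARD('d)
      \<le> L powr d * E powr d * t\<^sub>0 powr (- d)"
  proof -
    have pos: "0 < 16 * t + 2 / a\<^sub>0" using t a\<^sub>0 by (simp add: add_pos_pos)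
    have "sqrt (L * (16 * t + 2 / a\<^sub>0)) ^ CARD('d) = (L * (16 * t + 2 / a\<^sub>0)) powr d"
    proof -
      have w: "0 < L * (16 * t + 2 / a\<^sub>0)" using L2 pos by simp
      then have "sqrt (L * (16 * t + 2 / a\<^sub>0)) ^ CARD('d)
          = ((L * (16 * t + 2 / a\<^sub>0)) powr (1 / 2)) powr real CARD('d)"
        by (simp add: powr_half_sqrt[OF less_imp_le[OF w]] powr_realpow)
      then show ?thesis by (simp add: powr_powr d_def)
    qed
    also have "\<dots> = L powr d * (16 * t + 2 / a\<^sub>0) powr d"
      using L2 pos by (simp add: powr_mult)
    finally have eq: "gauss_max TYPE('d) t * sqrt (L * (16 * t + 2 / a\<^sub>0)) ^ CARD('d)
        = L powr d * ((16 * t + 2 / a\<^sub>0) / (2 * pi * t)) powr d"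
      unfolding gauss_max_def d_def[symmetric]
      using t pos by (simp add: powr_divide powr_minus_divide)
    have "(16 * t + 2 / a\<^sub>0) / (2 * pi * t) \<le> E / t\<^sub>0"
    proof -
      \<comment> \<open>The first summand uses \<open>t\<^sub>0 \<le> 1\<close>, the second
        \<open>t\<^sub>0 \<le> t\<close>.\<close>
      have "t\<^sub>0 * (16 * t + 2 / a\<^sub>0) \<le> 1 * (16 * t) + t * (2 / a\<^sub>0)"
        unfolding distrib_left using t\<^sub>0 t a\<^sub>0 by (intro add_mono mult_right_mono) auto
      also have "\<dots> = E * t" by (simp add: E_def algebra_simps)
      also have "\<dots> \<le> E * (2 * pi * t)" using E t pi_ge_two by simp
      finally show ?thesis using t\<^sub>0 t by (simp add: field_simps)
    qed
    then have "((16 * t + 2 / a\<^sub>0) / (2 * pi * t)) powr d \<le> (E / t\<^sub>0) powr d"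
      using pos t d by (intro powr_mono2) auto
    also have "(E / t\<^sub>0) powr d = E powr d * t\<^sub>0 powr (- d)"
      using E t\<^sub>0 by (simp add: powr_divide powr_minus_divide)
    finally have "((16 * t + 2 / a\<^sub>0) / (2 * pi * t)) powr d \<le> E powr d * t\<^sub>0 powr (- d)" .
    from mult_left_mono[OF this, of "L powr d"] show ?thesis
      unfolding eq by (simp add: mult.assoc)
  qed
  \<comment> \<open>Gives the tail term, which has no such factors, the same powers of
    \<open>L\<close> and \<open>t\<^sub>0\<close> as the term from the ball.\<close>
  have one: "1 \<le> 2 powr d * L powr d * t\<^sub>0 powr (- d)"
  proof -
    have "1 \<le> (2 * L) powr d" using L2 d by (intro ge_one_powr_ge_zero) auto
    moreover have "1 \<le> t\<^sub>0 powr (- d)"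
      using t\<^sub>0 d powr_mono2'[of "- d" t\<^sub>0 1] by simp
    ultimately have "1 * 1 \<le> (2 * L) powr d * t\<^sub>0 powr (- d)" by (intro mult_mono) auto
    then show ?thesis using L2 by (simp add: powr_mult)
  qed
  define W where "W = L powr d * t\<^sub>0 powr (- d)"
  have W: "0 \<le> W" by (simp add: W_def)
  have regroup: "88 * k * g / (N * t) * (V * A) + 16 * k / t * P * (1 / N) * M
      = k / (N * t) * (88 * V * (g * A) + 16 * P * M * 1)" for k g N A P
    by (simp add: algebra_simps add_divide_distrib)
  have "88 * (1 + L) * gauss_max TYPE('d) t / (real n * t)
          * (V * sqrt (L * (16 * t + 2 / a\<^sub>0)) ^ CARD('d))
        + 16 * (1 + L) / t * 2 powr d * (1 / real n) * M
      = (1 + L) / (real n * t) * (88 * V * (gauss_max TYPE('d) t * sqrt (L * (16 * t + 2 / a\<^sub>0)) ^ CARD('d))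
        + 16 * 2 powr d * M * 1)"
    by (rule regroup)
  also have "\<dots> \<le> (1 + L) / (real n * t) * (88 * V * (L powr d * E powr d * t\<^sub>0 powr (- d))
        + 16 * 2 powr d * M * (2 powr d * L powr d * t\<^sub>0 powr (- d)))"
    using L2 t V M one c n by (intro mult_left_mono add_mono) auto
  also have "\<dots> = (1 + L) * (W * (88 * V * E powr d + 16 * (2 powr d * 2 powr d) * M) / (real n * t))"
    by (simp add: W_def algebra_simps add_divide_distrib)
  also have "2 powr d * 2 powr d = 4 powr d" by (simp flip: powr_mult)
  also have "(1 + L) * (W * (88 * V * E powr d + 16 * 4 powr d * M) / (real n * t))
      \<le> (3 * L) * (W * (88 * V * E powr d + 16 * 4 powr d * M) / (real n * t))"
    using L2 t V M W by (intro mult_right_mono) auto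
  also have "\<dots> = 3 * (88 * V * E powr d + 16 * 4 powr d * M) * (L * L powr d) * (1 / real n) * t\<^sub>0 powr (- d) / t"
    by (simp add: W_def)
  also have "L * L powr d = L powr (1 + d)" using L2 by (simp add: powr_add)
  finally show ?thesis
    using score_risk_kde_score_le[OF p t n a\<^sub>0 M moment]
    unfolding d_def L_def V_def E_def by (meson ennreal_leI order.trans)
qed

lemma nn_integral_inverse_Icc:
  assumes "0 < a" "a \<le> b" "0 \<le> K"
  shows "(\<integral>\<^sup>+t. ennreal (K / t) * indicator {a..b} t \<partial>lborel) = ennreal (K * (ln b - ln a))"
proof -
  have "(\<integral>\<^sup>+t. ennreal (K / t) * indicator {a..b} t \<partial>lborel) = ennreal (K * ln b - K * ln a)"
    using assms by (intro nn_integral_FTC_Icc) (auto intro!: derivative_eq_intros)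
  then show ?thesis by (simp add: right_diff_distrib)
qed

text \<open>The integral of \<open>1 / t\<close> over the time interval is
  \<open>(T\<^sub>1 + T\<^sub>2) * ln n\<close>, so polynomial limits of integration cost only one
  logarithm. This raises the exponent of the logarithm from \<open>1 + d / 2\<close> to
  \<open>2 + d / 2\<close>, with \<open>d\<close> the dimension.\<close>

lemma integrated_risk_kde_score:
  fixes p :: "real ^ 'd::finite \<Rightarrow> real"
  assumes p: "prob_density p" and sg: "sub_gaussian \<sigma> p" and T: "0 < T\<^sub>1" "0 < T\<^sub>2"
  shows "polylog_bounded
    (\<lambda>n. integrated_risk (return borel 0) kde_score p n (real n powr (- T\<^sub>1)) (real n powr T\<^sub>2))
    (\<lambda>n. real n powr (- 1) * (real n powr (- T\<^sub>1)) powr (- (real CARD('d) / 2)))"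
proof -
  obtain a M where a: "0 < a" and M: "0 \<le> M"
    and moment: "(\<integral>\<^sup>+y. ennreal (exp (a * (norm y)\<^sup>2)) \<partial>law p) \<le> ennreal M"
    using sub_gaussian_exp_moment[OF p sg] .
  define K where "K = 3 * (88 * unit_ball_vol (real CARD('d)) * (16 + 2 / a) powr (real CARD('d) / 2)
        + 16 * 4 powr (real CARD('d) / 2) * M)"
  have "0 < 16 + 2 / a" using a by (simp add: add_pos_pos)
  then have "0 < (16 + 2 / a) powr (real CARD('d) / 2)" by simp
  then have K: "0 < K" using M unfolding K_def
    by (intro mult_pos_pos add_pos_nonneg) auto
  have "integrated_risk (return borel 0) kde_score p n (real n powr (- T\<^sub>1)) (real n powr T\<^sub>2)
      \<le> ennreal (K * (T\<^sub>1 + T\<^sub>2) * ln (real n) powr (2 + real CARD('d) / 2)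
          * (real n powr (- 1) * (real n powr (- T\<^sub>1)) powr (- (real CARD('d) / 2))))"
    if n: "2 \<le> n" for n
  proof -
    define t\<^sub>0 where "t\<^sub>0 = real n powr (- T\<^sub>1)"
    define S where "S = K * ln (real n) powr (1 + real CARD('d) / 2) * (1 / real n)
      * t\<^sub>0 powr (- (real CARD('d) / 2))"
    have t\<^sub>0: "0 < t\<^sub>0" "t\<^sub>0 \<le> 1"
      using n T powr_mono[of "- T\<^sub>1" 0 "real n"] by (auto simp: t\<^sub>0_def)
    have S: "0 \<le> S" using K n by (simp add: S_def)
    have T1: "1 \<le> real n powr T\<^sub>2" using n T by (intro ge_one_powr_ge_zero) auto
    have "integrated_risk (return borel 0) kde_score p n t\<^sub>0 (real n powr T\<^sub>2)
        \<le> (\<integral>\<^sup>+t. ennreal (S / t) * indicator {t\<^sub>0..real n powr T\<^sub>2} t \<partial>lborel)"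
      unfolding integrated_risk_def S_def K_def
      using score_risk_kde_score_polylog[OF p n a M moment t\<^sub>0]
      by (intro nn_integral_mono) (auto split: split_indicator)
    also have "\<dots> = ennreal (S * (ln (real n powr T\<^sub>2) - ln t\<^sub>0))"
      using t\<^sub>0 T1 S by (intro nn_integral_inverse_Icc) auto
    also have "ln (real n powr T\<^sub>2) - ln t\<^sub>0 = (T\<^sub>1 + T\<^sub>2) * ln (real n)"
      using n by (simp add: t\<^sub>0_def ln_powr algebra_simps)
    also have "S * ((T\<^sub>1 + T\<^sub>2) * ln (real n)) = K * (T\<^sub>1 + T\<^sub>2)
        * (ln (real n) * ln (real n) powr (1 + real CARD('d) / 2))
        * (real n powr (- 1) * t\<^sub>0 powr (- (real CARD('d) / 2)))"
      using n by (simp add: S_def powr_minus_divide)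
    also have "ln (real n) * ln (real n) powr (1 + real CARD('d) / 2) = ln (real n) powr (2 + real CARD('d) / 2)"
      using n powr_add[of "ln (real n)" 1 "1 + real CARD('d) / 2"] by simp
    finally show ?thesis unfolding t\<^sub>0_def .
  qed
  moreover have "0 < K * (T\<^sub>1 + T\<^sub>2)" using K T by simp
  ultimately show ?thesis unfolding polylog_bounded_def by blast
qed

theorem corollary3p7:
  "\<exists>(Q :: real measure) (s :: 'd::finite score_rule). score_estimator Q s \<and>
     (\<forall>(p\<^sub>0 :: real ^ 'd \<Rightarrow> real) \<sigma>\<^sub>0. prob_density p\<^sub>0 \<and> sub_gaussian \<sigma>\<^sub>0 p\<^sub>0 \<longrightarrow>
        (\<forall>T\<^sub>1>0. \<forall>T\<^sub>2>0. polylog_bounded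
           (\<lambda>n. integrated_risk Q s p\<^sub>0 n (real n powr (- T\<^sub>1)) (real n powr T\<^sub>2))
           (\<lambda>n. real n powr (- 1) * (real n powr (- T\<^sub>1)) powr (- (real CARD('d) / 2)))) \<and>
        (\<forall>\<beta>>0. \<forall>T\<^sub>2>0. polylog_bounded
           (\<lambda>n. integrated_risk Q s p\<^sub>0 n
              (real n powr (- (2 / (2 * \<beta> + real CARD('d))))) (real n powr T\<^sub>2))
           (\<lambda>n. real n powr (- (2 * \<beta> / (2 * \<beta> + real CARD('d)))))))"
proof (intro exI conjI allI impI)
  show "score_estimator (return borel 0) (kde_score :: 'd score_rule)"
    by (rule score_estimator_kde_score)
next
  fix p\<^sub>0 :: "real ^ 'd \<Rightarrow> real" and \<sigma>\<^sub>0 T\<^sub>1 T\<^sub>2 :: real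
  assume "prob_density p\<^sub>0 \<and> sub_gaussian \<sigma>\<^sub>0 p\<^sub>0" "0 < T\<^sub>1" "0 < T\<^sub>2"
  then show "polylog_bounded
      (\<lambda>n. integrated_risk (return borel 0) kde_score p\<^sub>0 n (real n powr (- T\<^sub>1)) (real n powr T\<^sub>2))
      (\<lambda>n. real n powr (- 1) * (real n powr (- T\<^sub>1)) powr (- (real CARD('d) / 2)))"
    using integrated_risk_kde_score by blast
next
  fix p\<^sub>0 :: "real ^ 'd \<Rightarrow> real" and \<sigma>\<^sub>0 \<beta> T\<^sub>2 :: real
  assume *: "prob_density p\<^sub>0 \<and> sub_gaussian \<sigma>\<^sub>0 p\<^sub>0" and \<beta>: "0 < \<beta>" and T: "0 < T\<^sub>2"
  have pos: "0 < 2 * \<beta> + real CARD('d)" using \<beta> by (simp add: add_pos_nonneg)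
  \<comment> \<open>The second claim is the first with
    \<open>T\<^sub>1 = 2 / (2 * \<beta> + d)\<close>, \<open>d\<close> being the dimension; the
    exponents of \<open>n\<close> add up to the stated rate.\<close>
  then have "- 1 + - (2 / (2 * \<beta> + real CARD('d))) * - (real CARD('d) / 2)
      = - (2 * \<beta> / (2 * \<beta> + real CARD('d)))"
    by (simp add: field_simps)
  then have "real n powr (- 1) * (real n powr (- (2 / (2 * \<beta> + real CARD('d))))) powr (- (real CARD('d) / 2))
      = real n powr (- (2 * \<beta> / (2 * \<beta> + real CARD('d))))" for n
    unfolding powr_powr powr_add[symmetric] by (rule arg_cong)
  then show "polylog_bounded
      (\<lambda>n. integrated_risk (return borel 0) kde_score p\<^sub>0 n
        (real n powr (- (2 / (2 * \<beta> + real CARD('d))))) (real n powr T\<^sub>2))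
      (\<lambda>n. real n powr (- (2 * \<beta> / (2 * \<beta> + real CARD('d)))))"
    using integrated_risk_kde_score[of p\<^sub>0 \<sigma>\<^sub>0 "2 / (2 * \<beta> + real CARD('d))" T\<^sub>2] * T pos by simp
qed

end
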